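(* Let $\Omega$ be an arbitrary index set, $B=B_\Omega$, $C=C_\Omega$. Let $L$ be a PSD linear functional on $B$ and let $\mu$ be the Radon measure on $X(C)$ associated to $L$, i.e. the unique Radon measure on $X(C)$ with $L(f)=\int \hat f_C\,d\mu$ for all $f\in C$. The following are equivalent: (1) There exists a Radon measure $\nu$ on $X(B)$ such that $L(f) = \int \hat{f}_B\, d\nu$ for all $f\in B$. (2) For all Borel sets $E$ of $X(C)$, $\mu(E) = \sup\{ \mu(K) \mid K \text{ compact},\ K\subseteq X(B)\cap E\}$. (3) $\mu(X(C)) = \sup\{ \mu(K) \mid K \text{ compact},\ K \subseteq X(B)\}$. (4) $\mu$ is supported by a Borel set $E$ of $X(C)$ such that $E \subseteq X(B)$. Moreover, if this is the case, then $\nu(E) = \sup\{ \mu(K) \mid K \text{ compact},\ K\subseteq E\}$ for all Borel sets $E$ of $X(B)$. In particular, $\nu$ is uniquely determined by $\mu$.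
   Context: $B_\Omega=\mathbb{R}[x_i,\frac{1}{1+x_i^2}\mid i\in\Omega]$ is the localization of $\mathbb{R}[x_i\mid i\in\Omega]$ at the multiplicative set generated by the $1+x_i^2$, $i\in\Omega$, and $C_\Omega=\mathbb{R}[\frac{1}{1+x_i^2},\frac{x_i}{1+x_i^2}\mid i\in\Omega]$ is the $\mathbb{R}$-subalgebra of $B_\Omega$ generated by the indicated elements. A linear functional is PSD if it is $\ge 0$ on finite sums of squares. For a commutative $\mathbb{R}$-algebra $D$ with $1$, $X(D)$ is the set of all unital ring homomorphisms $\alpha:D\to\mathbb{R}$; for $a\in D$, $\hat a_D(\alpha)=\alpha(a)$; $X(D)$ has the weakest topology making all $\hat a_D$ continuous. $X(B_\Omega)$ is identified with $\mathbb{R}^\Omega$ (product topology), and $X(C_\Omega)$ with the compact space $\mathbb{S}^\Omega$, where $\mathbb{S}=\{(y,z)\in\mathbb{R}^2\mid (y-\frac12)^2+z^2=\frac14\}$ (coordinates $y_i\leftrightarrow\frac{1}{1+x_i^2}$, $z_i\leftrightarrow\frac{x_i}{1+x_i^2}$). The restriction map $\alpha\mapsto\alpha|_C$ identifies $X(B)$ with a (dense) topological subspace of $X(C)$, and $X(B)$ is regarded as a subset of $X(C)$ in this way. A Radon measure is a positive measure on the Borel $\sigma$-algebra that is locally finite and inner regular (each Borel set can be approximated from within by compact sets). PSD linear functionals on $C$ correspond bijectively to Radon measures $\mu$ on $X(C)$ via $L(f)=\int\hat f_C\,d\mu$ ($f\in C$); the measure associated to a PSD functional $L$ on $B$ is the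 one corresponding to $L|_C$. A measure $\mu$ on $(X,\Sigma)$ is supported by $Y\subseteq X$ if $\mu(E)=0$ for every $E\in\Sigma$ with $E\cap Y=\emptyset$. *)

theory Defs
  imports "HOL-Analysis.Analysis" "HOL-Library.Poly_Mapping"
begin

section \<open>Polynomials in the variables indexed by \<open>\<Omega>\<close>\<close>

text \<open>A monomial is a finitely supported exponent vector, a polynomial a finitely supported
  family of coefficients indexed by monomials. The index set \<open>\<Omega>\<close> is an arbitrary
  (possibly empty) set of elements of the type \<open>'i\<close>.\<close>

type_synonym 'i mpoly = "('i \<Rightarrow>\<^sub>0 nat) \<Rightarrow>\<^sub>0 real"

definition const_poly :: "real \<Rightarrow> 'i mpoly" where
  "const_poly c = Poly_Mapping.single 0 c"

definition var_poly :: "'i \<Rightarrow> 'i mpoly" where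
  "var_poly i = Poly_Mapping.single (Poly_Mapping.single i 1) 1"

definition polys :: "'i set \<Rightarrow> 'i mpoly set" where
  "polys \<Omega> = {p. \<forall>m\<in>Poly_Mapping.keys p. Poly_Mapping.keys m \<subseteq> \<Omega>}"

inductive_set denoms :: "'i set \<Rightarrow> 'i mpoly set" for \<Omega> :: "'i set" where
  one: "1 \<in> denoms \<Omega>"
| mult: "s \<in> denoms \<Omega> \<Longrightarrow> i \<in> \<Omega> \<Longrightarrow> s * (1 + var_poly i ^ 2) \<in> denoms \<Omega>"

lemma denoms_mult: "t \<in> denoms \<Omega> \<Longrightarrow> s \<in> denoms \<Omega> \<Longrightarrow> s * t \<in> denoms \<Omega>"
proof (induction rule: denoms.induct)
  case one then show ?case by simp
next
  case (mult t i)
  then show ?case using denoms.mult[of "s * t" \<Omega> i] by (simp add: mult.assoc)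
qed

lemma denoms_mono: "s \<in> denoms \<Omega> \<Longrightarrow> \<Omega> \<subseteq> \<Omega>' \<Longrightarrow> s \<in> denoms \<Omega>'"
  by (induction rule: denoms.induct) (auto intro: denoms.intros)

lemma denoms_UNIV: "s \<in> denoms \<Omega> \<Longrightarrow> s \<in> denoms UNIV"
  by (rule denoms_mono) auto

text \<open>The retraction sending the variables outside \<open>\<Omega>\<close> to 0.\<close>

lift_definition retract_poly :: "'i set \<Rightarrow> 'i mpoly \<Rightarrow> 'i mpoly"
  is "\<lambda>\<Omega> p m. if Poly_Mapping.keys m \<subseteq> \<Omega> then p m else 0"
  by (rule finite_subset) auto

lemma lookup_retract:
  "Poly_Mapping.lookup (retract_poly \<Omega> p) m =
    (if Poly_Mapping.keys m \<subseteq> \<Omega> then Poly_Mapping.lookup p m else 0)"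
  by transfer simp

lemma keys_add_nat:
  fixes l q :: "'i \<Rightarrow>\<^sub>0 nat"
  shows "Poly_Mapping.keys (l + q) = Poly_Mapping.keys l \<union> Poly_Mapping.keys q"
  by (auto simp: in_keys_iff lookup_add)

lemma retract_add: "retract_poly \<Omega> (p + q) = retract_poly \<Omega> p + retract_poly \<Omega> q"
  by (rule poly_mapping_eqI) (simp add: lookup_retract lookup_add)

lemma retract_diff: "retract_poly \<Omega> (p - q) = retract_poly \<Omega> p - retract_poly \<Omega> q"
  by (rule poly_mapping_eqI) (simp add: lookup_retract lookup_minus)

lemma retract_0 [simp]: "retract_poly \<Omega> 0 = 0"
  by (rule poly_mapping_eqI) (simp add: lookup_retract)

lemma retract_1 [simp]: "retract_poly \<Omega> 1 = 1"
  by (rule poly_mapping_eqI) (auto simp: lookup_retract lookup_one when_def)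

lemma retract_mult: "retract_poly \<Omega> (p * q) = retract_poly \<Omega> p * retract_poly \<Omega> q"
proof (rule poly_mapping_eqI)
  fix k
  let ?r = "\<lambda>p. Poly_Mapping.lookup (retract_poly \<Omega> p)"
  let ?l = "Poly_Mapping.lookup"
  have eq: "?r p l * (\<Sum>m. (?r q m when k = l + m)) =
      (if Poly_Mapping.keys k \<subseteq> \<Omega> then ?l p l * (\<Sum>m. (?l q m when k = l + m)) else 0)" for l
  proof (cases "Poly_Mapping.keys l \<subseteq> \<Omega>")
    case True
    then have "(\<lambda>m. (?r q m when k = l + m)) =
        (\<lambda>m. if Poly_Mapping.keys k \<subseteq> \<Omega> then (?l q m when k = l + m) else 0)"
      by (auto simp: fun_eq_iff lookup_retract when_def keys_add_nat)
    then show ?thesis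
      using True unfolding lookup_retract[of _ p] by (simp only:) simp
  next
    case False
    then have "Poly_Mapping.keys k \<subseteq> \<Omega> \<Longrightarrow> (\<lambda>m. (?l q m when k = l + m)) = (\<lambda>m. 0)"
      by (auto simp: fun_eq_iff when_def keys_add_nat)
    then show ?thesis
      using False unfolding lookup_retract[of _ p] by (cases "Poly_Mapping.keys k \<subseteq> \<Omega>") (simp_all only:, simp_all)
  qed
  show "?r (p * q) k = ?l (retract_poly \<Omega> p * retract_poly \<Omega> q) k"
    unfolding lookup_mult eq by (simp add: lookup_retract lookup_mult)
qed

lemma retract_polys: "p \<in> polys \<Omega> \<Longrightarrow> retract_poly \<Omega> p = p"
  by (rule poly_mapping_eqI) (auto simp: lookup_retract polys_def in_keys_iff)

lemma polys_retract:
  assumes "retract_poly \<Omega> p = p" shows "p \<in> polys \<Omega>"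
  unfolding polys_def
proof (rule CollectI, rule ballI, rule ccontr)
  fix m assume m: "m \<in> Poly_Mapping.keys p" "\<not> Poly_Mapping.keys m \<subseteq> \<Omega>"
  then have "Poly_Mapping.lookup (retract_poly \<Omega> p) m = 0"
    by (simp only: lookup_retract if_False)
  then show False using m(1) assms by (simp add: in_keys_iff)
qed

lemma polys_iff: "p \<in> polys \<Omega> \<longleftrightarrow> retract_poly \<Omega> p = p"
  using retract_polys polys_retract by blast

lemma retract_var:
  "retract_poly \<Omega> (var_poly i) = (if i \<in> \<Omega> then var_poly i else 0)"
  by (rule poly_mapping_eqI) (auto simp: lookup_retract var_poly_def lookup_single when_def)

lemma retract_denoms: "s \<in> denoms \<Omega>' \<Longrightarrow> retract_poly \<Omega> s \<in> denoms (\<Omega>' \<inter> \<Omega>)"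
  by (induction rule: denoms.induct)
    (auto simp: retract_mult retract_add retract_var power2_eq_square denoms.one
      intro: denoms.mult[unfolded power2_eq_square])

lemma denoms_empty: "s \<in> denoms {} \<Longrightarrow> s = 1"
  by (induction rule: denoms.induct) auto

lemma denoms_nonzero: "s \<in> denoms \<Omega> \<Longrightarrow> s \<noteq> 0"
  using retract_denoms[of s \<Omega> "{}"] denoms_empty by (metis inf_bot_right retract_0 zero_neq_one)

lemma denoms_polys: "s \<in> denoms \<Omega> \<Longrightarrow> s \<in> polys \<Omega>"
  by (induction rule: denoms.induct)
    (auto simp: polys_iff retract_mult retract_add retract_var power2_eq_square)


section \<open>The localization\<close>

definition frac_rel :: "'i mpoly \<times> 'i mpoly \<Rightarrow> 'i mpoly \<times> 'i mpoly \<Rightarrow> bool" where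
  "frac_rel = (\<lambda>(p, s) (q, t). s \<in> denoms UNIV \<and> t \<in> denoms UNIV \<and>
     (\<exists>u\<in>denoms UNIV. u * (p * t - q * s) = 0))"

lemma part_equivp_frac_rel: "part_equivp frac_rel"
proof (rule part_equivpI)
  show "\<exists>x. frac_rel x x"
    by (rule exI[of _ "(0, 1)"]) (auto simp: frac_rel_def intro: denoms.one)
  show "symp frac_rel"
  proof (rule sympI)
    fix x y :: "'i mpoly \<times> 'i mpoly"
    assume "frac_rel x y"
    then obtain p s q t u where *: "x = (p, s)" "y = (q, t)" "s \<in> denoms UNIV" "t \<in> denoms UNIV"
      "u \<in> denoms UNIV" "u * (p * t - q * s) = 0"
      by (auto simp: frac_rel_def split: prod.splits)
    then have "u * (q * s - p * t) = 0" by (simp add: algebra_simps)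
    with * show "frac_rel y x" by (auto simp: frac_rel_def)
  qed
  show "transp frac_rel"
  proof (rule transpI)
    fix x y z :: "'i mpoly \<times> 'i mpoly"
    assume "frac_rel x y" "frac_rel y z"
    then obtain p s q t r w u v where *: "x = (p, s)" "y = (q, t)" "z = (r, w)"
      "s \<in> denoms UNIV" "t \<in> denoms UNIV" "w \<in> denoms UNIV" "u \<in> denoms UNIV" "v \<in> denoms UNIV"
      and u: "u * (p * t - q * s) = 0" and v: "v * (q * w - r * t) = 0"
      unfolding frac_rel_def by (cases x, cases y, cases z) auto
    have "u * v * t * (p * w - r * s) = v * w * (u * (p * t - q * s)) + u * s * (v * (q * w - r * t))"
      by (simp add: algebra_simps)
    then have "u * v * t * (p * w - r * s) = 0" using u v by simp
    moreover have "u * v * t \<in> denoms UNIV" using * by (intro denoms_mult)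
    ultimately show "frac_rel x z" using * by (auto simp: frac_rel_def)
  qed
qed

text \<open>\<open>'i bfrac\<close> is the localization in the variables indexed by all of \<open>'i\<close>; the algebra
  \<open>B_alg \<Omega>\<close> below is carved out of it.\<close>

quotient_type 'i bfrac = "'i mpoly \<times> 'i mpoly" / partial: frac_rel
  by (rule part_equivp_frac_rel)

lemma frac_relI:
  "s \<in> denoms UNIV \<Longrightarrow> t \<in> denoms UNIV \<Longrightarrow> p * t = q * s \<Longrightarrow> frac_rel (p, s) (q, t)"
  by (auto simp: frac_rel_def intro: bexI[of _ 1] denoms.one)

lemma frac_rel_refl: "frac_rel (p, s) (p, s) \<longleftrightarrow> s \<in> denoms UNIV"
  by (auto simp: frac_rel_def intro: denoms.one)

lemma frac_relE:
  assumes "frac_rel x y"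
  obtains p s q t u where "x = (p, s)" "y = (q, t)" "s \<in> denoms UNIV" "t \<in> denoms UNIV"
    "u \<in> denoms UNIV" "u * (p * t) = u * (q * s)"
  using assms unfolding frac_rel_def by (cases x, cases y) (auto simp: right_diff_distrib)

instantiation bfrac :: (type) "{comm_ring_1, real_algebra_1}"
begin

lift_definition zero_bfrac :: "'a bfrac" is "(0, 1)"
  by (auto intro: frac_relI denoms.one)

lift_definition one_bfrac :: "'a bfrac" is "(1, 1)"
  by (auto intro: frac_relI denoms.one)

lift_definition plus_bfrac :: "'a bfrac \<Rightarrow> 'a bfrac \<Rightarrow> 'a bfrac"
  is "\<lambda>(p, s) (q, t). (p * t + q * s, s * t)"
proof -
  fix x x' y y' :: "'a mpoly \<times> 'a mpoly"
  assume "frac_rel x x'" "frac_rel y y'"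
  from \<open>frac_rel x x'\<close> obtain p s p' s' u where 1: "x = (p, s)" "x' = (p', s')" "s \<in> denoms UNIV"
    "s' \<in> denoms UNIV" "u \<in> denoms UNIV" "u * (p * s') = u * (p' * s)" by (rule frac_relE)
  from \<open>frac_rel y y'\<close> obtain q t q' t' v where 2: "y = (q, t)" "y' = (q', t')" "t \<in> denoms UNIV"
    "t' \<in> denoms UNIV" "v \<in> denoms UNIV" "v * (q * t') = v * (q' * t)" by (rule frac_relE)
  have "u * v * ((p * t + q * s) * (s' * t') - (p' * t' + q' * s') * (s * t)) =
     v * t * t' * (u * (p * s') - u * (p' * s)) + u * s * s' * (v * (q * t') - v * (q' * t))"
    by (simp add: algebra_simps)
  then have "u * v * ((p * t + q * s) * (s' * t') - (p' * t' + q' * s') * (s * t)) = 0"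
    using 1 2 by simp
  then show "frac_rel ((case x of (p, s) \<Rightarrow> \<lambda>(q, t). (p * t + q * s, s * t)) y)
     ((case x' of (p, s) \<Rightarrow> \<lambda>(q, t). (p * t + q * s, s * t)) y')"
    using 1 2 by (auto simp: frac_rel_def intro!: denoms_mult intro: bexI[of _ "u * v"])
qed

lift_definition times_bfrac :: "'a bfrac \<Rightarrow> 'a bfrac \<Rightarrow> 'a bfrac"
  is "\<lambda>(p, s) (q, t). (p * q, s * t)"
proof -
  fix x x' y y' :: "'a mpoly \<times> 'a mpoly"
  assume "frac_rel x x'" "frac_rel y y'"
  from \<open>frac_rel x x'\<close> obtain p s p' s' u where 1: "x = (p, s)" "x' = (p', s')" "s \<in> denoms UNIV"
    "s' \<in> denoms UNIV" "u \<in> denoms UNIV" "u * (p * s') = u * (p' * s)" by (rule frac_relE)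
  from \<open>frac_rel y y'\<close> obtain q t q' t' v where 2: "y = (q, t)" "y' = (q', t')" "t \<in> denoms UNIV"
    "t' \<in> denoms UNIV" "v \<in> denoms UNIV" "v * (q * t') = v * (q' * t)" by (rule frac_relE)
  have "u * v * ((p * q) * (s' * t') - (p' * q') * (s * t)) =
     v * q * t' * (u * (p * s') - u * (p' * s)) + u * p' * s * (v * (q * t') - v * (q' * t))"
    by (simp add: algebra_simps)
  then have "u * v * ((p * q) * (s' * t') - (p' * q') * (s * t)) = 0"
    using 1 2 by simp
  then show "frac_rel ((case x of (p, s) \<Rightarrow> \<lambda>(q, t). (p * q, s * t)) y)
     ((case x' of (p, s) \<Rightarrow> \<lambda>(q, t). (p * q, s * t)) y')"
    using 1 2 by (auto simp: frac_rel_def intro!: denoms_mult intro: bexI[of _ "u * v"])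
qed

lift_definition uminus_bfrac :: "'a bfrac \<Rightarrow> 'a bfrac" is "\<lambda>(p, s). (- p, s)"
  by (erule frac_relE) (auto simp: frac_rel_def right_diff_distrib)

lift_definition scaleR_bfrac :: "real \<Rightarrow> 'a bfrac \<Rightarrow> 'a bfrac"
  is "\<lambda>c (p, s). (const_poly c * p, s)"
proof -
  fix c and x y :: "'a mpoly \<times> 'a mpoly"
  assume "frac_rel x y"
  then obtain p s q t u where *: "x = (p, s)" "y = (q, t)" "s \<in> denoms UNIV" "t \<in> denoms UNIV"
    "u \<in> denoms UNIV" "u * (p * t) = u * (q * s)" by (rule frac_relE)
  have "u * ((const_poly c * p) * t - (const_poly c * q) * s) =
      const_poly c * (u * (p * t) - u * (q * s))"
    by (simp add: algebra_simps)
  then show "frac_rel (case x of (p, s) \<Rightarrow> (const_poly c * p, s)) (case y of (p, s) \<Rightarrow> (const_poly c * p, s))"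
    using * by (auto simp: frac_rel_def)
qed

definition minus_bfrac :: "'a bfrac \<Rightarrow> 'a bfrac \<Rightarrow> 'a bfrac" where
  "minus_bfrac x y = x + - y"

instance
proof
  fix a b c :: "'a bfrac" and r r' :: real
  have cadd: "const_poly (x + y) = (const_poly x + const_poly y :: 'a mpoly)" for x y
    by (simp add: const_poly_def single_add)
  have cmult: "const_poly (x * y) = (const_poly x * const_poly y :: 'a mpoly)" for x y
    by (simp add: const_poly_def mult_single)
  have c1: "const_poly 1 = (1 :: 'a mpoly)"
    by (simp add: const_poly_def)
  show "a * b * c = a * (b * c)"
    by transfer (simp add: split_paired_all frac_rel_refl;
        (intro frac_relI denoms_mult denoms.one; simp add: algebra_simps))
  show "a * b = b * a"
    by transfer (simp add: split_paired_all frac_rel_refl;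
        (intro frac_relI denoms_mult denoms.one; simp add: algebra_simps))
  show "1 * a = a"
    by transfer (simp add: split_paired_all frac_rel_refl;
        (intro frac_relI denoms_mult denoms.one; simp add: algebra_simps))
  show "(a + b) * c = a * c + b * c"
    by transfer (simp add: split_paired_all frac_rel_refl;
        (intro frac_relI denoms_mult denoms.one; simp add: algebra_simps))
  show "a * (b + c) = a * b + a * c"
    by transfer (simp add: split_paired_all frac_rel_refl;
        (intro frac_relI denoms_mult denoms.one; simp add: algebra_simps))
  show "a * 1 = a"
    by transfer (simp add: split_paired_all frac_rel_refl;
        (intro frac_relI denoms_mult denoms.one; simp add: algebra_simps))
  show "a + b + c = a + (b + c)"
    by transfer (simp add: split_paired_all frac_rel_refl;
        (intro frac_relI denoms_mult denoms.one; simp add: algebra_simps))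
  show "a + b = b + a"
    by transfer (simp add: split_paired_all frac_rel_refl;
        (intro frac_relI denoms_mult denoms.one; simp add: algebra_simps))
  show "0 + a = a"
    by transfer (simp add: split_paired_all frac_rel_refl;
        (intro frac_relI denoms_mult denoms.one; simp add: algebra_simps))
  show "- a + a = 0"
    by transfer (simp add: split_paired_all frac_rel_refl;
        (intro frac_relI denoms_mult denoms.one; simp add: algebra_simps))
  show "r *\<^sub>R (a + b) = r *\<^sub>R a + r *\<^sub>R b"
    by transfer (simp add: split_paired_all frac_rel_refl;
        (intro frac_relI denoms_mult denoms.one; simp add: algebra_simps))
  show "(r + r') *\<^sub>R a = r *\<^sub>R a + r' *\<^sub>R a"
    by transfer (simp add: split_paired_all frac_rel_refl cadd;
        (intro frac_relI denoms_mult denoms.one; simp add: algebra_simps))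
  show "r *\<^sub>R r' *\<^sub>R a = (r * r') *\<^sub>R a"
    by transfer (simp add: split_paired_all frac_rel_refl cmult;
        (intro frac_relI denoms_mult denoms.one; simp add: algebra_simps))
  show "1 *\<^sub>R a = a"
    by transfer (simp add: split_paired_all frac_rel_refl c1;
        (intro frac_relI denoms_mult denoms.one; simp add: algebra_simps))
  show "r *\<^sub>R a * b = r *\<^sub>R (a * b)"
    by transfer (simp add: split_paired_all frac_rel_refl;
        (intro frac_relI denoms_mult denoms.one; simp add: algebra_simps))
  show "a * r *\<^sub>R b = r *\<^sub>R (a * b)"
    by transfer (simp add: split_paired_all frac_rel_refl;
        (intro frac_relI denoms_mult denoms.one; simp add: algebra_simps))
  show "a - b = a + - b"
    by (simp add: minus_bfrac_def)
  show "(0 :: 'a bfrac) \<noteq> 1"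
    by transfer (auto simp: frac_rel_def dest: denoms_nonzero)
qed

end


text \<open>\<open>Frac p s\<close> is the fraction \<open>p / s\<close>; it is a junk value unless \<open>s \<in> denoms UNIV\<close>.\<close>

definition Frac :: "'i mpoly \<Rightarrow> 'i mpoly \<Rightarrow> 'i bfrac" where
  "Frac p s = abs_bfrac (p, s)"

lemma Frac_eq_iff_UNIV:
  assumes "s \<in> denoms UNIV" "t \<in> denoms UNIV"
  shows "Frac p s = Frac q t \<longleftrightarrow> (\<exists>u\<in>denoms UNIV. u * (p * t - q * s) = 0)"
proof -
  have "Frac p s = Frac q t \<longleftrightarrow> frac_rel (p, s) (q, t)"
    unfolding Frac_def using Quotient3_rel[OF Quotient3_bfrac, of "(p, s)" "(q, t)"] assms
    by (auto simp: frac_rel_def intro: denoms.one)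
  then show ?thesis using assms by (simp add: frac_rel_def)
qed

text \<open>For \<open>p\<close>, \<open>q\<close> and \<open>s\<close>, \<open>t\<close> over \<open>\<Omega>\<close>, equality of fractions is the one in the localization of
  \<open>polys \<Omega>\<close> at \<open>denoms \<Omega>\<close>; so \<open>B_alg \<Omega>\<close> below is that localization for every \<open>\<Omega>\<close>.\<close>

lemma Frac_eq_iff:
  assumes "p \<in> polys \<Omega>" "q \<in> polys \<Omega>" "s \<in> denoms \<Omega>" "t \<in> denoms \<Omega>"
  shows "Frac p s = Frac q t \<longleftrightarrow> (\<exists>u\<in>denoms \<Omega>. u * (p * t - q * s) = 0)"
proof
  assume "Frac p s = Frac q t"
  then obtain u where u: "u \<in> denoms UNIV" "u * (p * t - q * s) = 0"
    using Frac_eq_iff_UNIV[of s t p q] assms denoms_UNIV by blast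
  have "retract_poly \<Omega> u * (p * t - q * s) = retract_poly \<Omega> (u * (p * t - q * s))"
    using assms by (simp add: retract_mult retract_diff retract_polys denoms_polys)
  also have "\<dots> = 0" using u by simp
  finally show "\<exists>u\<in>denoms \<Omega>. u * (p * t - q * s) = 0"
    using retract_denoms[OF u(1), of \<Omega>] by auto
next
  assume "\<exists>u\<in>denoms \<Omega>. u * (p * t - q * s) = 0"
  then show "Frac p s = Frac q t"
    using Frac_eq_iff_UNIV[of s t p q] assms denoms_UNIV by blast
qed

lemma Frac_add: "s \<in> denoms UNIV \<Longrightarrow> t \<in> denoms UNIV \<Longrightarrow>
    Frac p s + Frac q t = Frac (p * t + q * s) (s * t)"
  unfolding Frac_def by (subst plus_bfrac.abs_eq) (auto intro!: frac_relI)

lemma Frac_mult: "s \<in> denoms UNIV \<Longrightarrow> t \<in> denoms UNIV \<Longrightarrow>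
    Frac p s * Frac q t = Frac (p * q) (s * t)"
  unfolding Frac_def by (subst times_bfrac.abs_eq) (auto intro!: frac_relI)

lemma Frac_scaleR: "s \<in> denoms UNIV \<Longrightarrow> c *\<^sub>R Frac p s = Frac (const_poly c * p) s"
  unfolding Frac_def by (subst scaleR_bfrac.abs_eq) (auto intro!: frac_relI)

lemma Frac_0: "Frac 0 1 = 0" and Frac_1: "Frac 1 1 = 1"
  by (simp_all add: Frac_def zero_bfrac.abs_eq one_bfrac.abs_eq)


section \<open>The algebras \<open>B\<close> and \<open>C\<close>\<close>

definition B_alg :: "'i set \<Rightarrow> 'i bfrac set" where
  "B_alg \<Omega> = {Frac p s | p s. p \<in> polys \<Omega> \<and> s \<in> denoms \<Omega>}"

definition real_subalgebra :: "'a::{comm_ring_1, real_algebra_1} set \<Rightarrow> bool" where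
  "real_subalgebra A \<longleftrightarrow> subspace A \<and> 1 \<in> A \<and> (\<forall>a\<in>A. \<forall>b\<in>A. a * b \<in> A)"

definition C_alg :: "'i set \<Rightarrow> 'i bfrac set" where
  "C_alg \<Omega> = real_subalgebra hull
     (\<Union>i\<in>\<Omega>. {Frac 1 (1 + var_poly i ^ 2), Frac (var_poly i) (1 + var_poly i ^ 2)})"

lemma real_subalgebra_hull: "real_subalgebra (real_subalgebra hull G)"
  by (rule hull_in) (auto simp: real_subalgebra_def intro: subspace_Inter)

lemma denoms_gen: "i \<in> \<Omega> \<Longrightarrow> 1 + var_poly i ^ 2 \<in> denoms \<Omega>"
  using denoms.mult[OF denoms.one, of i \<Omega>] by simp

lemma polys_const: "const_poly c \<in> polys \<Omega>"
  by (auto simp: polys_def const_poly_def)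

lemma polys_add: "p \<in> polys \<Omega> \<Longrightarrow> q \<in> polys \<Omega> \<Longrightarrow> p + q \<in> polys \<Omega>"
  and polys_mult: "p \<in> polys \<Omega> \<Longrightarrow> q \<in> polys \<Omega> \<Longrightarrow> p * q \<in> polys \<Omega>"
  and polys_0: "0 \<in> polys \<Omega>" and polys_1: "1 \<in> polys \<Omega>"
  and polys_var: "i \<in> \<Omega> \<Longrightarrow> var_poly i \<in> polys \<Omega>"
  by (auto simp: polys_iff retract_add retract_mult retract_var)

lemma B_algI: "p \<in> polys \<Omega> \<Longrightarrow> s \<in> denoms \<Omega> \<Longrightarrow> Frac p s \<in> B_alg \<Omega>"
  by (auto simp: B_alg_def)

lemma real_subalgebra_B_alg: "real_subalgebra (B_alg \<Omega>)"
  unfolding real_subalgebra_def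
proof (intro conjI ballI subspaceI)
  show "0 \<in> B_alg \<Omega>" "1 \<in> B_alg \<Omega>"
    using B_algI[OF polys_0 denoms.one, of \<Omega>] B_algI[OF polys_1 denoms.one, of \<Omega>]
    by (simp_all add: Frac_0 Frac_1)
next
  fix a b assume "a \<in> B_alg \<Omega>" "b \<in> B_alg \<Omega>"
  then obtain p s q t where *: "a = Frac p s" "b = Frac q t" "p \<in> polys \<Omega>" "q \<in> polys \<Omega>"
    "s \<in> denoms \<Omega>" "t \<in> denoms \<Omega>" by (auto simp: B_alg_def)
  then show "a + b \<in> B_alg \<Omega>" "a * b \<in> B_alg \<Omega>"
    by (simp_all add: Frac_add Frac_mult denoms_UNIV B_algI polys_add polys_mult denoms_mult
        denoms_polys)
next
  fix a c assume "a \<in> B_alg \<Omega>"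
  then obtain p s where "a = Frac p s" "p \<in> polys \<Omega>" "s \<in> denoms \<Omega>"
    by (auto simp: B_alg_def)
  then show "c *\<^sub>R a \<in> B_alg \<Omega>"
    by (simp add: Frac_scaleR denoms_UNIV B_algI polys_mult polys_const)
qed

text \<open>\<open>B_alg \<Omega>\<close> is also the subalgebra generated by the \<open>x_i\<close> and \<open>1 / (1 + x_i^2)\<close>.\<close>

lemma B_alg_eq_hull:
  "B_alg \<Omega> = real_subalgebra hull (\<Union>i\<in>\<Omega>. {Frac (var_poly i) 1, Frac 1 (1 + var_poly i ^ 2)})"
    (is "_ = real_subalgebra hull ?G")
proof
  show "real_subalgebra hull ?G \<subseteq> B_alg \<Omega>"
    by (rule hull_minimal)
      (auto intro!: real_subalgebra_B_alg B_algI denoms_gen polys_1 polys_var denoms.one)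
next
  let ?H = "real_subalgebra hull ?G"
  have H: "subspace ?H \<and> 1 \<in> ?H \<and> (\<forall>a\<in>?H. \<forall>b\<in>?H. a * b \<in> ?H)"
    using real_subalgebra_hull[of ?G] unfolding real_subalgebra_def[of ?H] .
  have mulH: "a * b \<in> ?H" if "a \<in> ?H" "b \<in> ?H" for a b using H that by blast
  have add: "a + b \<in> ?H" if "a \<in> ?H" "b \<in> ?H" for a b using H that by (blast intro: subspace_add)
  have scale: "c *\<^sub>R a \<in> ?H" if "a \<in> ?H" for c a using H that by (blast intro: subspace_scale)
  have F1mult: "Frac (p * q) 1 = Frac p 1 * Frac q 1" for p q :: "'a mpoly"
    by (simp add: Frac_mult denoms.one)
  have den: "Frac 1 s \<in> ?H" if "s \<in> denoms \<Omega>" for s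
    using that
  proof (induction rule: denoms.induct)
    case one then show ?case using H by (simp add: Frac_1)
  next
    case (mult s i)
    have "Frac 1 s * Frac 1 (1 + var_poly i ^ 2) \<in> ?H"
      using mult by (intro mulH[OF mult.IH] hull_inc) auto
    then show ?case
      using mult by (simp add: Frac_mult denoms_UNIV denoms_gen)
  qed
  have var: "Frac (Poly_Mapping.single (Poly_Mapping.single i n) 1) 1 \<in> ?H" if "i \<in> \<Omega>" for i n
  proof (induction n)
    case 0 then show ?case using H by (simp add: Frac_1)
  next
    case (Suc n)
    have "Poly_Mapping.single (Poly_Mapping.single i (Suc n)) 1 =
        var_poly i * (Poly_Mapping.single (Poly_Mapping.single i n) 1 :: 'a mpoly)"
      by (simp add: var_poly_def mult_single flip: single_add)
    moreover have "Frac (var_poly i) 1 \<in> ?H" using that by (intro hull_inc) auto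
    ultimately show ?case using Suc mulH by (simp add: F1mult)
  qed
  have mono: "Frac (Poly_Mapping.single m 1) 1 \<in> ?H" if "Poly_Mapping.keys m \<subseteq> \<Omega>" for m
    using that
  proof (induction m rule: update_induct)
    case const then show ?case using H by (simp add: Frac_1)
  next
    case (update m i n)
    have "Poly_Mapping.update i n m = Poly_Mapping.single i n + m"
      using update(1) by (intro poly_mapping_eqI) (auto simp: lookup_update lookup_add lookup_single in_keys_iff when_def)
    then have "(Poly_Mapping.single (Poly_Mapping.update i n m) 1 :: 'a mpoly) =
        Poly_Mapping.single (Poly_Mapping.single i n) 1 * Poly_Mapping.single m 1"
      by (simp add: mult_single)
    moreover have "i \<in> \<Omega>" "Poly_Mapping.keys m \<subseteq> \<Omega>"
      using update by (auto simp: in_keys_iff lookup_update split: if_splits)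
    ultimately show ?case using update var mulH by (simp add: F1mult)
  qed
  have pol: "Frac p 1 \<in> ?H" if "p \<in> polys \<Omega>" for p
    using that
  proof (induction p rule: update_induct)
    case const then show ?case using H by (simp add: Frac_0 subspace_0)
  next
    case (update p m c)
    have eq: "Poly_Mapping.update m c p = const_poly c * Poly_Mapping.single m 1 + p"
      using update(1) by (intro poly_mapping_eqI)
        (auto simp: const_poly_def mult_single lookup_update lookup_add lookup_single in_keys_iff when_def)
    have "Frac (Poly_Mapping.update m c p) 1 = c *\<^sub>R Frac (Poly_Mapping.single m 1) 1 + Frac p 1"
      unfolding eq by (simp add: Frac_scaleR Frac_add denoms.one)
    moreover have "Poly_Mapping.keys m \<subseteq> \<Omega>" "p \<in> polys \<Omega>"
      using update by (auto simp: polys_def in_keys_iff lookup_update split: if_splits)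
    ultimately show ?case using update mono add scale by simp
  qed
  show "B_alg \<Omega> \<subseteq> ?H"
  proof
    fix a assume "a \<in> B_alg \<Omega>"
    then obtain p s where *: "a = Frac p s" "p \<in> polys \<Omega>" "s \<in> denoms \<Omega>"
      by (auto simp: B_alg_def)
    then have "a = Frac p 1 * Frac 1 s" by (simp add: Frac_mult denoms.one denoms_UNIV)
    then show "a \<in> ?H" using * pol den mulH by simp
  qed
qed

lemma C_alg_subset_B_alg: "C_alg \<Omega> \<subseteq> B_alg \<Omega>"
  unfolding C_alg_def
  by (rule hull_minimal) (auto intro!: real_subalgebra_B_alg B_algI denoms_gen polys_1 polys_var)

lemma real_subalgebra_C_alg: "real_subalgebra (C_alg \<Omega>)"
  unfolding C_alg_def by (rule real_subalgebra_hull)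


section \<open>Functionals, characters and Radon measures\<close>

definition psd_functional :: "'a::{comm_ring_1, real_algebra_1} set \<Rightarrow> ('a \<Rightarrow> real) \<Rightarrow> bool" where
  "psd_functional D L \<longleftrightarrow>
     (\<forall>a\<in>D. \<forall>b\<in>D. L (a + b) = L a + L b) \<and> (\<forall>c. \<forall>a\<in>D. L (c *\<^sub>R a) = c * L a) \<and>
     (\<forall>(n::nat) f. (\<forall>k<n. f k \<in> D) \<longrightarrow> 0 \<le> L (\<Sum>k<n. f k ^ 2))"

text \<open>Ring homomorphisms from the subalgebra \<open>D\<close> to the reals, as functions that are \<open>undefined\<close>
  outside \<open>D\<close>.\<close>

definition characters :: "'a::{comm_ring_1, real_algebra_1} set \<Rightarrow> ('a \<Rightarrow> real) set" where
  "characters D = {\<alpha> \<in> extensional D. \<alpha> 1 = 1 \<and>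
     (\<forall>a\<in>D. \<forall>b\<in>D. \<alpha> (a + b) = \<alpha> a + \<alpha> b \<and> \<alpha> (a * b) = \<alpha> a * \<alpha> b)}"

definition X_top :: "'a::{comm_ring_1, real_algebra_1} set \<Rightarrow> ('a \<Rightarrow> real) topology" where
  "X_top D = topology_generated_by {{\<alpha> \<in> characters D. \<alpha> a \<in> U} | a U. a \<in> D \<and> open U}"

lemma topspace_X_top: "1 \<in> D \<Longrightarrow> topspace (X_top D) = characters D"
  unfolding X_top_def topology_generated_by_topspace by (auto intro!: exI[of _ 1] exI[of _ UNIV])

text \<open>\<open>X(B)\<close> as a subset of \<open>X(C)\<close>, through restriction.\<close>

definition res_C :: "'i set \<Rightarrow> ('i bfrac \<Rightarrow> real) \<Rightarrow> ('i bfrac \<Rightarrow> real)" where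
  "res_C \<Omega> \<alpha> = restrict \<alpha> (C_alg \<Omega>)"

definition XB_in_XC :: "'i set \<Rightarrow> ('i bfrac \<Rightarrow> real) set" where
  "XB_in_XC \<Omega> = res_C \<Omega> ` characters (B_alg \<Omega>)"

lemma XB_in_XC_subset: "XB_in_XC \<Omega> \<subseteq> characters (C_alg \<Omega>)"
  using C_alg_subset_B_alg[of \<Omega>] real_subalgebra_C_alg[of \<Omega>]
  by (auto simp: XB_in_XC_def res_C_def characters_def real_subalgebra_def subset_iff subspace_add)

definition borel_sets :: "'a topology \<Rightarrow> 'a set set" where
  "borel_sets T = sigma_sets (topspace T) {U. openin T U}"

definition radon_measure :: "'a topology \<Rightarrow> 'a measure \<Rightarrow> bool" where
  "radon_measure T M \<longleftrightarrow> space M = topspace T \<and> sets M = borel_sets T \<and>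
     (\<forall>x\<in>topspace T. \<exists>U. openin T U \<and> x \<in> U \<and> emeasure M U < \<infinity>) \<and>
     (\<forall>E\<in>borel_sets T. emeasure M E = (SUP K\<in>{K. compactin T K \<and> K \<subseteq> E}. emeasure M K))"

text \<open>\<open>L(f)\<close> is the integral of evaluation at \<open>f\<close>, which in particular is integrable.\<close>

definition represents :: "('a \<Rightarrow> real) measure \<Rightarrow> 'a set \<Rightarrow> ('a \<Rightarrow> real) \<Rightarrow> bool" where
  "represents M D L \<longleftrightarrow> (\<forall>f\<in>D. has_bochner_integral M (\<lambda>\<alpha>. \<alpha> f) (L f))"

definition supported_by :: "'a measure \<Rightarrow> 'a set \<Rightarrow> bool" where
  "supported_by M Y \<longleftrightarrow> (\<forall>E\<in>sets M. E \<inter> Y = {} \<longrightarrow> emeasure M E = 0)"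

end

(*
Restriction is a homeomorphism of X(B) onto its image in X(C): every b in B has a denominator
d = 1/t, t a product of factors 1 + x_i^2, with d b in C, and a character of B is nonzero at d.
A representing Radon measure on X(B) therefore pushes forward to a Radon measure on the compact
space X(C) representing L on C, which is mu by the Stone-Weierstrass theorem; this gives (2), the
formula for nu, and uniqueness.

For (4) ==> (1), pull mu back to X(B).  The resulting nu represents L on C, and it remains to pass
to B.  For h in B choose d as above with h^2 d in C.  Then h^2 (1 - (1-d)^n) lies in C and increases
to h^2 pointwise on X(B), so by monotone convergence it suffices that L(h^2 (1-d)^n) --> 0.  Since d
and 1 - d are sums of squares, n (1-d)^n <= sum_{k<n} (1-d)^k <= 1/d in the sense of L, hence
L(h^2 (1-d)^n) <= L(h^2 / d) / n.
*)
theory Submission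
  imports Defs
begin

section \<open>Hausdorff function spaces and Radon measures\<close>

text \<open>\<open>X_top D\<close> is the subspace topology that the product space of all functions
  induces on \<open>characters D\<close> (\<open>X_top_eq_top_of_set\<close>). Both character spaces
  thus sit in one Hausdorff function type, compactness no longer depends on the surrounding space,
  and a Radon measure becomes a measure on a trace of \<open>borel\<close> whose values are suprema
  over \<open>compact\<close> sets.

  The index set may be uncountable, and this shapes two steps. Measurability of the image
  \<open>XB_in_XC \<Omega>\<close> is never claimed: inner approximations mention compact sets only,
  and (4) is exploited by restricting the measure to a Borel set E inside the image. And monotone
  convergence needs a sequence, so h^2 is approximated through powers of a single 1 - d, with d
  chosen for h, and not through an exhaustion of all variables.

  The bound on L(h^2 (1-d)^n) concerns L itself, since no integral formula on B is known at that
  point. The geometric series is therefore estimated inside the algebra.\<close>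

lemma open_vimage_component:
  assumes "open U" shows "open {f. f i \<in> U}"
  using product_topology_basis'[of "{()}" "\<lambda>_. U" "\<lambda>_. i"] assms by simp

text \<open>Declaring only the \<open>t2_space\<close> instance would clash with the \<open>t0_space\<close> arity inherited from
  the metric on functions with countable domain.\<close>

instance "fun" :: (type, t0_space) t0_space
proof
  fix x y :: "'a \<Rightarrow> 'b"
  assume "x \<noteq> y"
  then obtain i where "x i \<noteq> y i" by blast
  then obtain U where "open U" "\<not> (x i \<in> U \<longleftrightarrow> y i \<in> U)"
    using t0_space_class.t0_space[OF \<open>x i \<noteq> y i\<close>] by blast
  then show "\<exists>U. open U \<and> \<not> (x \<in> U \<longleftrightarrow> y \<in> U)"
    by (intro exI[of _ "{f. f i \<in> U}"]) (auto intro: open_vimage_component)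
qed

instance "fun" :: (type, t1_space) t1_space
proof
  fix x y :: "'a \<Rightarrow> 'b"
  assume "x \<noteq> y"
  then obtain i where "x i \<noteq> y i" by blast
  then obtain U where "open U" "x i \<in> U" "y i \<notin> U"
    by (meson t1_space)
  then show "\<exists>U. open U \<and> x \<in> U \<and> y \<notin> U"
    by (intro exI[of _ "{f. f i \<in> U}"]) (auto intro: open_vimage_component)
qed

instance "fun" :: (type, t2_space) t2_space
proof
  fix x y :: "'a \<Rightarrow> 'b"
  assume "x \<noteq> y"
  then obtain i where "x i \<noteq> y i" by blast
  then obtain U V where "open U" "open V" "x i \<in> U" "y i \<in> V" "U \<inter> V = {}"
    by (meson hausdorff)
  then show "\<exists>U V. open U \<and> open V \<and> x \<in> U \<and> y \<in> V \<and> U \<inter> V = {}"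
    by (intro exI[of _ "{f. f i \<in> U}"] exI[of _ "{f. f i \<in> V}"])
      (auto intro: open_vimage_component)
qed

section \<open>Radon measures on subspaces of a Hausdorff type\<close>

lemma borel_sets_top_of_set: "borel_sets (top_of_set S) = sets (restrict_space borel S)"
proof -
  have "{(\<lambda>x. x) -` A \<inter> S |A. A \<in> sigma_sets UNIV {U. open U}} =
      sigma_sets S {(\<lambda>x. x) -` A \<inter> S |A. A \<in> {U. open U}}"
    by (rule sigma_sets_vimage_commute) auto
  moreover have "{(\<lambda>x. x) -` A \<inter> S |A. A \<in> {U. open U}} = {U. openin (top_of_set S) U}"
    by (auto simp: openin_open)
  moreover have "(\<inter>) S ` \<A> = {(\<lambda>x. x) -` A \<inter> S |A. A \<in> \<A>}" for \<A>
    by auto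
  ultimately show ?thesis
    unfolding borel_sets_def sets_restrict_space sets_borel topspace_euclidean_subtopology by simp
qed

text \<open>Compactness of a subset of S is the same in S and in the ambient space. Inner regularity
  can therefore be phrased with \<open>compact\<close>, which makes suprema over different subspaces
  comparable.\<close>

lemma radon_measureD:
  assumes "radon_measure (top_of_set S) M"
  shows "space M = S" "sets M = sets (restrict_space borel S)"
    "E \<in> sets M \<Longrightarrow> emeasure M E = (SUP K\<in>{K. compact K \<and> K \<subseteq> E}. emeasure M K)"
proof -
  show *: "space M = S" "sets M = sets (restrict_space borel S)"
    using assms by (auto simp: radon_measure_def borel_sets_top_of_set)
  assume E: "E \<in> sets M"
  have "E \<subseteq> S" using sets.sets_into_space[OF E] * by simp
  then have "{K. compactin (top_of_set S) K \<and> K \<subseteq> E} = {K. compact K \<and> K \<subseteq> E}"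
    by (auto simp: compactin_subtopology)
  then show "emeasure M E = (SUP K\<in>{K. compact K \<and> K \<subseteq> E}. emeasure M K)"
    using assms E by (simp add: radon_measure_def)
qed

lemma compact_in_restrict_borel:
  fixes K :: "'a::t2_space set"
  shows "compact K \<Longrightarrow> K \<subseteq> S \<Longrightarrow> K \<in> sets (restrict_space borel S)"
  by (auto simp: sets_restrict_space intro!: image_eqI[of _ _ K] borel_closed compact_imp_closed)

text \<open>For a finite measure the whole space witnesses local finiteness, and monotonicity gives
  one half of inner regularity; only the other half has to be supplied.\<close>

lemma radon_measureI:
  fixes S :: "'a::t2_space set"
  assumes "finite_measure M" "space M = S" "sets M = sets (restrict_space borel S)"
    and "\<And>E. E \<in> sets M \<Longrightarrow> emeasure M E \<le> (SUP K\<in>{K. compact K \<and> K \<subseteq> E}. emeasure M K)"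
  shows "radon_measure (top_of_set S) M"
  unfolding radon_measure_def
proof (intro conjI ballI)
  interpret finite_measure M by fact
  show "space M = topspace (top_of_set S)" "sets M = borel_sets (top_of_set S)"
    using assms by (simp_all add: borel_sets_top_of_set)
  show "\<exists>U. openin (top_of_set S) U \<and> x \<in> U \<and> emeasure M U < \<infinity>"
    if "x \<in> topspace (top_of_set S)" for x
    using that by (intro exI[of _ S]) (auto simp: less_top[symmetric])
  fix E assume "E \<in> borel_sets (top_of_set S)"
  then have E: "E \<in> sets M" using assms by (simp add: borel_sets_top_of_set)
  have "E \<subseteq> S" using sets.sets_into_space[OF E] assms by simp
  then have "{K. compactin (top_of_set S) K \<and> K \<subseteq> E} = {K. compact K \<and> K \<subseteq> E}"
    by (auto simp: compactin_subtopology)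
  moreover have "(SUP K\<in>{K. compact K \<and> K \<subseteq> E}. emeasure M K) \<le> emeasure M E"
    using E by (auto intro!: SUP_least emeasure_mono)
  ultimately show "emeasure M E = (SUP K\<in>{K. compactin (top_of_set S) K \<and> K \<subseteq> E}. emeasure M K)"
    using assms(4)[OF E] by (simp add: antisym)
qed

lemma radon_measure_restrict:
  fixes S :: "'a::t2_space set"
  assumes M: "radon_measure (top_of_set S) M" "finite_measure M" and E: "E \<in> sets M"
  shows "radon_measure (top_of_set E) (restrict_space M E)"
proof (rule radon_measureI)
  note D = radon_measureD[OF M(1)]
  have ES: "E \<subseteq> S" using sets.sets_into_space[OF E] D by simp
  show "finite_measure (restrict_space M E)"
    using M(2) E by (intro finite_measure_restrict_space) auto
  show sp: "space (restrict_space M E) = E" using ES D by (auto simp: space_restrict_space)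
  show st: "sets (restrict_space M E) = sets (restrict_space borel E)"
    using D(2) ES by (auto simp: sets_restrict_space image_image Int_absorb1 Int_assoc[symmetric])
  fix F assume F: "F \<in> sets (restrict_space M E)"
  then have FE: "F \<subseteq> E" using sets.sets_into_space sp by blast
  have FM: "F \<in> sets M" using F E by (auto simp: sets_restrict_space)
  have "(SUP K\<in>{K. compact K \<and> K \<subseteq> F}. emeasure M K) =
      (SUP K\<in>{K. compact K \<and> K \<subseteq> F}. emeasure (restrict_space M E) K)"
    using FE E by (intro SUP_cong) (auto simp: emeasure_restrict_space)
  then show "emeasure (restrict_space M E) F \<le>
      (SUP K\<in>{K. compact K \<and> K \<subseteq> F}. emeasure (restrict_space M E) K)"
    using D(3)[OF FM] FE E by (simp add: emeasure_restrict_space)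
qed

section \<open>Transport of Radon measures along continuous injections\<close>

lemma continuous_on_measurable_restrict:
  fixes r :: "'a::topological_space \<Rightarrow> 'b::topological_space"
  assumes "continuous_on S r" "r ` S \<subseteq> T" "sets M = sets (restrict_space borel S)"
  shows "r \<in> measurable M (restrict_space borel T)"
proof -
  have "r \<in> measurable (restrict_space borel S) (restrict_space borel T)"
    using assms borel_measurable_continuous_on_restrict[of S r]
    by (intro measurable_restrict_space2) (auto simp: space_restrict_space)
  then show ?thesis using measurable_cong_sets[OF assms(3) refl] by blast
qed

lemma emeasure_distr_image:
  assumes "r \<in> measurable N T" "inj_on r (space N)" "A \<subseteq> space N" "r ` A \<in> sets T"
  shows "emeasure (distr N T r) (r ` A) = emeasure N A"
proof -
  have "r -` (r ` A) \<inter> space N = A" using assms(2,3) by (auto dest: inj_onD)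
  then show ?thesis using assms by (simp add: emeasure_distr)
qed

text \<open>A compact K inside the preimage of E has compact image inside E, and injectivity gives
  the image exactly the mass of K. So inner approximations of the preimage push forward to inner
  approximations of E.\<close>

lemma radon_measure_distr:
  fixes r :: "'a::t2_space \<Rightarrow> 'b::t2_space"
  assumes N: "radon_measure (top_of_set S) N" "finite_measure N"
    and r: "continuous_on S r" "inj_on r S" "r ` S \<subseteq> T"
  shows "radon_measure (top_of_set T) (distr N (restrict_space borel T) r)"
proof (rule radon_measureI)
  note D = radon_measureD[OF N(1)]
  let ?M = "distr N (restrict_space borel T) r"
  have meas: "r \<in> measurable N (restrict_space borel T)"
    using r D by (intro continuous_on_measurable_restrict)
  show "finite_measure ?M" using N(2) meas by (rule finite_measure.finite_measure_distr)
  show "space ?M = T" "sets ?M = sets (restrict_space borel T)" by (simp_all add: space_restrict_space)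
  fix E assume E: "E \<in> sets ?M"
  have F: "r -` E \<inter> S \<in> sets N" using measurable_sets[OF meas, of E] E D by simp
  have "emeasure ?M E = emeasure N (r -` E \<inter> S)" using meas E D by (simp add: emeasure_distr)
  also have "\<dots> = (SUP K\<in>{K. compact K \<and> K \<subseteq> r -` E \<inter> S}. emeasure N K)" by (rule D(3)[OF F])
  also have "\<dots> \<le> (SUP K\<in>{K. compact K \<and> K \<subseteq> E}. emeasure ?M K)"
  proof (rule SUP_mono)
    fix K assume "K \<in> {K. compact K \<and> K \<subseteq> r -` E \<inter> S}"
    then have K: "compact K" "K \<subseteq> S" "r ` K \<subseteq> E" by auto
    have "compact (r ` K)" using K r by (meson compact_continuous_image continuous_on_subset)
    moreover from this have "r ` K \<in> sets (restrict_space borel T)"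
      using K r by (intro compact_in_restrict_borel) auto
    then have "emeasure ?M (r ` K) = emeasure N K"
      using K r meas D by (intro emeasure_distr_image) auto
    ultimately show "\<exists>K'\<in>{K. compact K \<and> K \<subseteq> E}. emeasure N K \<le> emeasure ?M K'"
      using K by (intro bexI[of _ "r ` K"]) auto
  qed
  finally show "emeasure ?M E \<le> (SUP K\<in>{K. compact K \<and> K \<subseteq> E}. emeasure ?M K)" .
qed

lemma radon_measure_eq_SUP_distr:
  fixes r :: "'a::t2_space \<Rightarrow> 'b::t2_space"
  assumes N: "radon_measure (top_of_set S) N" and hom: "homeomorphism S (r ` S) r e"
    and T: "r ` S \<subseteq> T" and E: "E \<in> sets N"
  shows "emeasure N E =
    (SUP K\<in>{K. compact K \<and> K \<subseteq> r ` E}. emeasure (distr N (restrict_space borel T) r) K)"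
proof -
  note D = radon_measureD[OF N]
  let ?M = "distr N (restrict_space borel T) r"
  have r: "continuous_on S r" "inj_on r S" and e: "continuous_on (r ` S) e"
    and er: "\<And>x. x \<in> S \<Longrightarrow> e (r x) = x"
    using hom by (auto simp: homeomorphism_def intro: inj_on_inverseI)
  have meas: "r \<in> measurable N (restrict_space borel T)"
    using r T D by (intro continuous_on_measurable_restrict)
  have ES: "E \<subseteq> S" using sets.sets_into_space[OF E] D by simp
  have img: "emeasure ?M (r ` K) = emeasure N K" "compact (r ` K)" if "compact K" "K \<subseteq> S" for K
  proof -
    show c: "compact (r ` K)" using that r by (meson compact_continuous_image continuous_on_subset)
    then have "r ` K \<in> sets (restrict_space borel T)"
      using that T by (intro compact_in_restrict_borel) auto
    then show "emeasure ?M (r ` K) = emeasure N K"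
      using that r meas D by (intro emeasure_distr_image) auto
  qed
  have "{K. compact K \<and> K \<subseteq> r ` E} = (\<lambda>K. r ` K) ` {K. compact K \<and> K \<subseteq> E}"
  proof (intro equalityI subsetI)
    fix K assume "K \<in> {K. compact K \<and> K \<subseteq> r ` E}"
    then have K: "compact K" "K \<subseteq> r ` E" by auto
    have "compact (e ` K)" using K ES by (intro compact_continuous_image continuous_on_subset[OF e]) auto
    moreover have "e ` K \<subseteq> E" using K er ES by (force simp: subset_iff)
    moreover have "K = r ` e ` K"
    proof -
      have "r (e y) = y" if "y \<in> K" for y using that K er ES by (force simp: subset_iff)
      then show ?thesis by (simp add: image_image)
    qed
    ultimately show "K \<in> (\<lambda>K. r ` K) ` {K. compact K \<and> K \<subseteq> E}" by blast
  qed (use img ES in auto)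
  then have "(SUP K\<in>{K. compact K \<and> K \<subseteq> r ` E}. emeasure ?M K) =
      (SUP K\<in>{K. compact K \<and> K \<subseteq> E}. emeasure ?M (r ` K))"
    by (simp add: image_image)
  also have "\<dots> = (SUP K\<in>{K. compact K \<and> K \<subseteq> E}. emeasure N K)"
    using img ES by (intro SUP_cong) auto
  finally show ?thesis using D(3)[OF E] by simp
qed

section \<open>Uniqueness of Radon measures from integrals over a separating function ring\<close>

lemma has_bochner_integral_mono:
  fixes f g :: "'a \<Rightarrow> real"
  assumes "has_bochner_integral M f x" "has_bochner_integral M g y"
    and "\<And>a. a \<in> space M \<Longrightarrow> f a \<le> g a"
  shows "x \<le> y"
  using assms integral_mono[of M f g] by (simp add: has_bochner_integral_iff)

text \<open>Choose a compact A that nearly exhausts S - K for N, and a ring function f that is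
  nearly 1 on K and nearly 0 on A. The common integral of f is nearly at least M(K) and at most
  about N(S - A), which is close to N(K).\<close>

lemma radon_measure_le_of_integrals_eq:
  fixes S :: "'a::t2_space set"
  assumes "function_ring_on R S"
    and M: "radon_measure (top_of_set S) M" "finite_measure M"
    and N: "radon_measure (top_of_set S) N" "finite_measure N"
    and eq: "\<And>f. f \<in> R \<Longrightarrow> \<exists>x. has_bochner_integral M f x \<and> has_bochner_integral N f x"
    and K: "compact K" "K \<subseteq> S"
  shows "measure M K \<le> measure N K"
proof (rule field_le_epsilon)
  fix \<epsilon> :: real assume "\<epsilon> > 0"
  interpret R: function_ring_on R S by fact
  interpret M: finite_measure M by fact
  interpret N: finite_measure N by fact
  note DM = radon_measureD[OF M(1)] and DN = radon_measureD[OF N(1)]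
  have KN: "K \<in> sets N" and KM: "K \<in> sets M"
    using K DN DM by (simp_all add: compact_in_restrict_borel)
  have "S - K \<in> sets N" using KN sets.compl_sets[OF KN] DN by simp
  \<comment> \<open>The case split keeps the bound nonnegative before it is cast to
    \<open>ennreal\<close>, where negative numbers collapse to 0; if it is negative, the empty set
    serves as A.\<close>
  have "\<exists>A. compact A \<and> A \<subseteq> S - K \<and> measure N (S - K) - \<epsilon> / 2 < measure N A"
  proof (cases "measure N (S - K) < \<epsilon> / 2")
    case True
    then show ?thesis by (intro exI[of _ "{}"]) auto
  next
    case False
    have "ennreal (measure N (S - K) - \<epsilon> / 2) < emeasure N (S - K)"
      using False \<open>\<epsilon> > 0\<close> by (auto simp: N.emeasure_eq_measure intro!: ennreal_lessI)
    also have "\<dots> = (SUP K'\<in>{K'. compact K' \<and> K' \<subseteq> S - K}. emeasure N K')"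
      by (rule DN(3)) fact
    finally obtain A where A: "compact A" "A \<subseteq> S - K"
      "ennreal (measure N (S - K) - \<epsilon> / 2) < emeasure N A" by (auto simp: less_SUP_iff)
    then show ?thesis using False
      by (auto simp: N.emeasure_eq_measure ennreal_less_iff intro!: exI[of _ A])
  qed
  then obtain A where A: "compact A" "A \<subseteq> S - K" "measure N (S - K) - \<epsilon> / 2 < measure N A"
    by blast
  have AN: "A \<in> sets N" using A DN by (auto intro!: compact_in_restrict_borel)
  have "measure N (S - A) \<le> measure N K + \<epsilon> / 2"
    using A K AN KN DN N.finite_measure_compl[OF AN] N.finite_measure_compl[OF KN] by auto
  \<comment> \<open>The bound 1/2 keeps \<open>\<delta>\<close> below 1, as the separation of A and
    K requires; the other bound limits the error over both total masses to
    \<open>\<epsilon> / 2\<close>. The summand 1 makes the denominator positive even for zero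
    measures.\<close>
  define \<delta> where "\<delta> = min (1 / 2) (\<epsilon> / (2 * (measure M S + measure N S + 1)))"
  have \<delta>: "0 < \<delta>" "\<delta> < 1"
    using \<open>\<epsilon> > 0\<close> by (auto simp: \<delta>_def add_nonneg_pos)
  have "\<delta> * (measure M S + measure N S) \<le> \<epsilon> / (2 * (measure M S + measure N S + 1)) * (measure M S + measure N S + 1)"
    using \<open>\<epsilon> > 0\<close> by (intro mult_mono) (auto simp: \<delta>_def)
  also have "\<dots> = \<epsilon> / 2"
  proof -
    have "measure M S + measure N S + 1 > 0" by (simp add: add_nonneg_pos)
    then show ?thesis by (simp add: field_simps)
  qed
  finally have \<delta>': "\<delta> * (measure M S + measure N S) \<le> \<epsilon> / 2" .
  \<comment> \<open>This is the separation of disjoint closed sets from the proof of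
    Stone-Weierstrass; uniform density of the ring is not invoked.\<close>
  have "\<exists>f\<in>R. f ` S \<subseteq> {0..1} \<and> (\<forall>x\<in>A. f x < \<delta>) \<and> (\<forall>x\<in>K. f x > 1 - \<delta>)"
    by (rule R.two) (use A K \<delta> compact_imp_closed in auto)
  then obtain f where f: "f \<in> R" "f ` S \<subseteq> {0..1}"
    "\<And>x. x \<in> A \<Longrightarrow> f x < \<delta>" "\<And>x. x \<in> K \<Longrightarrow> f x > 1 - \<delta>"
    by blast
  obtain x where x: "has_bochner_integral M f x" "has_bochner_integral N f x" using eq f by blast
  \<comment> \<open>On S, f dominates the indicator of K minus \<open>\<delta>\<close>, and it is
    dominated by the indicator of S - A plus \<open>\<delta>\<close>. The constant is written with
    \<open>indicator S\<close> so that its integral is computed as a mass.\<close>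
  have "measure M K - \<delta> * measure M S \<le> x"
  proof (rule has_bochner_integral_mono)
    show "has_bochner_integral M (\<lambda>y. indicator K y - \<delta> * indicator S y) (measure M K - \<delta> * measure M S)"
      using KM DM(1,2) sets.top[of M]
      by (intro has_bochner_integral_diff has_bochner_integral_mult_right
        has_bochner_integral_real_indicator) (auto simp: less_top[symmetric])
    show "indicator K y - \<delta> * indicator S y \<le> f y" if "y \<in> space M" for y
      using that f(2) f(4)[of y] \<delta> DM K by (auto simp: indicator_def image_subset_iff; force)
  qed (fact x)
  moreover have "x \<le> measure N (S - A) + \<delta> * measure N S"
  proof (rule has_bochner_integral_mono)
    show "has_bochner_integral N (\<lambda>y. indicator (S - A) y + \<delta> * indicator S y) (measure N (S - A) + \<delta> * measure N S)"
      using AN DN(1,2) sets.top[of N] 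
      by (intro has_bochner_integral_add has_bochner_integral_mult_right
        has_bochner_integral_real_indicator) (auto simp: less_top[symmetric])
    show "f y \<le> indicator (S - A) y + \<delta> * indicator S y" if "y \<in> space N" for y
      using that f(2) f(3)[of y] \<delta> DN by (auto simp: indicator_def image_subset_iff; force)
  qed (fact x)
  ultimately show "measure M K \<le> measure N K + \<epsilon>"
    using \<delta>' \<open>measure N (S - A) \<le> measure N K + \<epsilon> / 2\<close> by (simp add: algebra_simps)
qed

lemma radon_measure_eqI_ring:
  fixes S :: "'a::t2_space set"
  assumes "function_ring_on R S"
    and M: "radon_measure (top_of_set S) M" "finite_measure M"
    and N: "radon_measure (top_of_set S) N" "finite_measure N"
    and eq: "\<And>f. f \<in> R \<Longrightarrow> \<exists>x. has_bochner_integral M f x \<and> has_bochner_integral N f x"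
  shows "M = N"
proof (rule measure_eqI)
  note DM = radon_measureD[OF M(1)] and DN = radon_measureD[OF N(1)]
  interpret M: finite_measure M by fact
  interpret N: finite_measure N by fact
  show "sets M = sets N" using DM DN by simp
  have *: "emeasure M K = emeasure N K" if "compact K" "K \<subseteq> S" for K
    using radon_measure_le_of_integrals_eq[OF assms(1) M N eq that]
      radon_measure_le_of_integrals_eq[OF assms(1) N M _ that] eq
    by (force simp: M.emeasure_eq_measure N.emeasure_eq_measure intro: antisym)
  fix E assume E: "E \<in> sets M"
  then have "E \<subseteq> S" using sets.sets_into_space DM by blast
  then have "(SUP K\<in>{K. compact K \<and> K \<subseteq> E}. emeasure M K) = (SUP K\<in>{K. compact K \<and> K \<subseteq> E}. emeasure N K)"
    by (intro SUP_cong) (auto simp: *)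
  then show "emeasure M E = emeasure N E" using DM(3)[of E] DN(3)[of E] E DM(2) DN(2) by simp
qed

section \<open>Characters and denominators\<close>

lemma real_subalgebraD:
  assumes "real_subalgebra D"
  shows "0 \<in> D" "1 \<in> D" "a \<in> D \<Longrightarrow> b \<in> D \<Longrightarrow> a + b \<in> D" "a \<in> D \<Longrightarrow> b \<in> D \<Longrightarrow> a * b \<in> D"
    "a \<in> D \<Longrightarrow> c *\<^sub>R a \<in> D" "a \<in> D \<Longrightarrow> b \<in> D \<Longrightarrow> a - b \<in> D" "a \<in> D \<Longrightarrow> a ^ n \<in> D"
proof -
  show *: "1 \<in> D" "a \<in> D \<Longrightarrow> b \<in> D \<Longrightarrow> a * b \<in> D" for a b
    using assms by (auto simp: real_subalgebra_def)
  show "a \<in> D \<Longrightarrow> a ^ n \<in> D" by (induction n) (auto intro: *)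
qed (use assms in \<open>auto simp: real_subalgebra_def subspace_0 subspace_add subspace_scale subspace_diff\<close>)

lemmas B_closed = real_subalgebraD[OF real_subalgebra_B_alg]
lemmas C_closed = real_subalgebraD[OF real_subalgebra_C_alg]

lemma characterD:
  assumes D: "real_subalgebra D" and \<alpha>: "\<alpha> \<in> characters D"
  shows "\<alpha> 1 = 1" "\<alpha> 0 = 0" "a \<in> D \<Longrightarrow> b \<in> D \<Longrightarrow> \<alpha> (a + b) = \<alpha> a + \<alpha> b"
    "a \<in> D \<Longrightarrow> b \<in> D \<Longrightarrow> \<alpha> (a * b) = \<alpha> a * \<alpha> b"
    "a \<in> D \<Longrightarrow> b \<in> D \<Longrightarrow> \<alpha> (a - b) = \<alpha> a - \<alpha> b" "a \<in> D \<Longrightarrow> \<alpha> (a ^ n) = \<alpha> a ^ n"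
    "a \<in> D \<Longrightarrow> \<alpha> (c *\<^sub>R a) = c * \<alpha> a"
proof -
  note cl = real_subalgebraD[OF D]
  show one: "\<alpha> 1 = 1"
    and add: "a \<in> D \<Longrightarrow> b \<in> D \<Longrightarrow> \<alpha> (a + b) = \<alpha> a + \<alpha> b"
    and mult: "a \<in> D \<Longrightarrow> b \<in> D \<Longrightarrow> \<alpha> (a * b) = \<alpha> a * \<alpha> b" for a b
    using \<alpha> by (auto simp: characters_def)
  show zero: "\<alpha> 0 = 0" using add[of 0 0] cl by simp
  show diff: "a \<in> D \<Longrightarrow> b \<in> D \<Longrightarrow> \<alpha> (a - b) = \<alpha> a - \<alpha> b" for a b
    using add[of "a - b" b] cl by simp
  show "a \<in> D \<Longrightarrow> \<alpha> (a ^ n) = \<alpha> a ^ n" by (induction n) (auto simp: one mult cl)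
  \<comment> \<open>A character need only be additive and multiplicative; on scalars it is a ring endomorphism of the
    reals, which is monotone because nonnegative reals are squares, and hence the identity.\<close>
  define \<phi> where "\<phi> c = \<alpha> (c *\<^sub>R 1)" for c
  have \<phi>_add: "\<phi> (x + y) = \<phi> x + \<phi> y" and \<phi>_mult: "\<phi> (x * y) = \<phi> x * \<phi> y"
    and \<phi>_diff: "\<phi> (x - y) = \<phi> x - \<phi> y" and \<phi>_1: "\<phi> 1 = 1" for x y
    using add[of "x *\<^sub>R 1" "y *\<^sub>R 1"] mult[of "x *\<^sub>R 1" "y *\<^sub>R 1"] diff[of "x *\<^sub>R 1" "y *\<^sub>R 1"] one cl
    by (simp_all add: \<phi>_def scaleR_add_left scaleR_diff_left mult.commute)
  have \<phi>_mono: "\<phi> x \<le> \<phi> y" if "x \<le> y" for x y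
  proof -
    have "0 \<le> \<phi> (sqrt (y - x)) * \<phi> (sqrt (y - x))" by (rule zero_le_square)
    also have "\<dots> = \<phi> y - \<phi> x" using that by (simp flip: \<phi>_mult \<phi>_diff)
    finally show ?thesis by simp
  qed
  have \<phi>_nat: "\<phi> (real n) = real n" for n
    by (induction n) (simp_all add: \<phi>_add \<phi>_1 \<phi>_diff[of 0 0, simplified])
  have \<phi>_0: "\<phi> 0 = 0" using \<phi>_nat[of 0] by simp
  have \<phi>_int: "\<phi> (of_int k) = of_int k" for k
    using \<phi>_nat \<phi>_diff[of 0] by (cases k rule: int_cases2) (auto simp: \<phi>_0)
  \<comment> \<open>Monotonicity and \<open>\<phi>_int\<close> trap n c and n \<open>\<phi>\<close>
    c between the same two consecutive integers.\<close>
  have "\<bar>\<phi> c - c\<bar> * real n \<le> 1" for c n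
  proof -
    have "of_int \<lfloor>real n * c\<rfloor> \<le> real n * \<phi> c" "real n * \<phi> c \<le> of_int (\<lfloor>real n * c\<rfloor> + 1)"
      using \<phi>_mono[of "of_int \<lfloor>real n * c\<rfloor>" "real n * c"]
        \<phi>_mono[of "real n * c" "of_int (\<lfloor>real n * c\<rfloor> + 1)"]
      unfolding \<phi>_mult \<phi>_nat \<phi>_int by linarith+
    moreover have "of_int \<lfloor>real n * c\<rfloor> \<le> real n * c" "real n * c \<le> of_int (\<lfloor>real n * c\<rfloor> + 1)"
      by linarith+
    ultimately have "\<bar>real n * \<phi> c - real n * c\<bar> \<le> 1" by linarith
    then show ?thesis unfolding right_diff_distrib[symmetric] abs_mult by (simp add: mult.commute)
  qed
  then have bound: "real n * \<bar>\<phi> c - c\<bar> \<le> 1" for c n by (simp add: mult.commute)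
  have "\<phi> c = c" for c
  proof (rule ccontr)
    assume "\<phi> c \<noteq> c"
    then obtain n where "1 < real n * \<bar>\<phi> c - c\<bar>"
      using reals_Archimedean3[of "\<bar>\<phi> c - c\<bar>"] by auto
    then show False using bound[of n c] by simp
  qed
  then show "a \<in> D \<Longrightarrow> \<alpha> (c *\<^sub>R a) = c * \<alpha> a"
    using mult[of "c *\<^sub>R 1" a] cl by (simp add: \<phi>_def)
qed

text \<open>Coordinates in D give exactly the generating sets of the weak topology, and coordinates
  outside D are constantly \<open>undefined\<close> on characters, so they contribute no further
  open sets.\<close>

lemma X_top_eq_top_of_set:
  assumes "1 \<in> D"
  shows "X_top D = top_of_set (characters D)"
proof (rule topology_eq[THEN iffD2], intro allI iffI)
  fix V
  let ?G = "{{\<alpha> \<in> characters D. \<alpha> a \<in> U} | a U. a \<in> D \<and> open U}"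
  assume "openin (X_top D) V"
  then have "generate_topology_on ?G V" by (simp add: X_top_def openin_topology_generated_by_iff)
  then show "openin (top_of_set (characters D)) V"
  proof induction
    case (Basis W)
    then obtain a U where "W = characters D \<inter> {\<alpha>. \<alpha> a \<in> U}" "open U" by auto
    then show ?case
      by (auto intro: openin_open_Int open_vimage_component)
  qed auto
next
  have "continuous_map (X_top D) euclidean (\<lambda>\<alpha>. \<alpha>)"
    unfolding euclidean_product_topology[symmetric]
  proof (rule continuous_map_coordinatewise_then_product)
    fix a
    show "continuous_map (X_top D) euclidean (\<lambda>\<alpha>. \<alpha> a)"
    proof (cases "a \<in> D")
      case True
      show ?thesis
        unfolding continuous_map_def topspace_X_top[OF assms]
        using True by (auto simp: X_top_def intro!: topology_generated_by_Basis)
    next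
      case False
      have "continuous_map (X_top D) euclidean (\<lambda>_. undefined)" by simp
      then show ?thesis
        by (rule continuous_map_eq)
          (use False in \<open>auto simp: topspace_X_top[OF assms] characters_def extensional_def\<close>)
    qed
  qed simp
  fix V assume "openin (top_of_set (characters D)) V"
  then obtain W where W: "open W" "V = characters D \<inter> W" by (auto simp: openin_open)
  then have "openin (X_top D) {\<alpha> \<in> topspace (X_top D). \<alpha> \<in> W}"
    using \<open>continuous_map (X_top D) euclidean (\<lambda>\<alpha>. \<alpha>)\<close> by (simp add: continuous_map_def)
  moreover have "{\<alpha> \<in> topspace (X_top D). \<alpha> \<in> W} = V" using W topspace_X_top[OF assms] by auto
  ultimately show "openin (X_top D) V" by simp
qed

section \<open>Generators of C and common denominators\<close>

lemma Frac_inverse: "s \<in> denoms UNIV \<Longrightarrow> Frac 1 s * Frac s 1 = 1"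
  by (auto simp: Frac_mult denoms.one Frac_1[symmetric] Frac_eq_iff_UNIV intro: denoms.one)

text \<open>The first identity is the equation of the circle \<open>(y - 1/2)^2 + z^2 = 1/4\<close>.
  Together they exhibit y and 1 - y as sums of squares of elements of C, the source of all later
  positivity and boundedness.\<close>

lemma Frac_generators:
  fixes i :: 'i
  defines "y \<equiv> Frac 1 (1 + var_poly i ^ 2)" and "z \<equiv> Frac (var_poly i) (1 + var_poly i ^ 2)"
  shows "y = y ^ 2 + z ^ 2" "1 - y = z ^ 2 + (1 - y) ^ 2"
proof -
  have den: "1 + var_poly i ^ 2 \<in> denoms UNIV" by (rule denoms_gen) simp
  have "y * (1 + Frac (var_poly i) 1 ^ 2) = y * Frac (1 + var_poly i ^ 2) 1"
    by (simp add: power2_eq_square Frac_mult denoms.one Frac_1[symmetric] Frac_add add.commute)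
  also have "\<dots> = 1" using Frac_inverse[OF den] by (simp add: y_def)
  finally have 1: "y * (1 + Frac (var_poly i) 1 ^ 2) = 1" .
  have 2: "z = y * Frac (var_poly i) 1" using den by (simp add: y_def z_def Frac_mult denoms.one)
  have "y ^ 2 + z ^ 2 = y * (y * (1 + Frac (var_poly i) 1 ^ 2))"
    by (simp add: 2 power2_eq_square algebra_simps)
  then show *: "y = y ^ 2 + z ^ 2" by (simp add: 1)
  then have z: "z ^ 2 = y - y ^ 2" by (metis add_diff_cancel_left')
  show "1 - y = z ^ 2 + (1 - y) ^ 2" unfolding z by (simp add: power2_eq_square algebra_simps)
qed

lemma Frac_one_in_C_alg: "t \<in> denoms \<Omega> \<Longrightarrow> Frac 1 t \<in> C_alg \<Omega>"
proof (induction rule: denoms.induct)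
  case one
  then show ?case by (simp add: Frac_1 C_closed)
next
  case (mult s i)
  have "Frac 1 (s * (1 + var_poly i ^ 2)) = Frac 1 s * Frac 1 (1 + var_poly i ^ 2)"
    using mult by (simp add: Frac_mult denoms_UNIV denoms_gen)
  moreover have "Frac 1 (1 + var_poly i ^ 2) \<in> C_alg \<Omega>"
    unfolding C_alg_def using mult by (intro hull_inc) auto
  ultimately show ?case using mult by (simp add: C_closed)
qed

text \<open>The elements that have such a denominator form a subalgebra, because denominators
  multiply and each 1/t lies in C. It contains every x_i, since x_i / (1 + x_i^2) is a generator of
  C.\<close>

lemma B_alg_common_denominator:
  assumes "b \<in> B_alg \<Omega>"
  obtains t where "t \<in> denoms \<Omega>" "Frac 1 t * b \<in> C_alg \<Omega>"
proof -
  let ?H = "{b. \<exists>t\<in>denoms \<Omega>. Frac 1 t * b \<in> C_alg \<Omega>}"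
  have split: "Frac 1 (s * t) = Frac 1 s * Frac 1 t" if "s \<in> denoms \<Omega>" "t \<in> denoms \<Omega>" for s t
    using that by (simp add: Frac_mult denoms_UNIV)
  have H: "b \<in> ?H" if "t \<in> denoms \<Omega>" "Frac 1 t * b \<in> C_alg \<Omega>" for t b
    using that by blast
  have gen: "Frac (var_poly i) (1 + var_poly i ^ 2) \<in> C_alg \<Omega>" if "i \<in> \<Omega>" for i
    unfolding C_alg_def using that by (intro hull_inc) auto
  have "B_alg \<Omega> \<subseteq> ?H"
    unfolding B_alg_eq_hull
  proof (rule hull_minimal)
    show "(\<Union>i\<in>\<Omega>. {Frac (var_poly i) 1, Frac 1 (1 + var_poly i ^ 2)}) \<subseteq> ?H"
    proof (intro UN_least subsetI)
      fix i x assume i: "i \<in> \<Omega>" and x: "x \<in> {Frac (var_poly i) 1, Frac 1 (1 + var_poly i ^ 2)}"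
      have "Frac 1 (1 + var_poly i ^ 2) * Frac (var_poly i) 1 \<in> C_alg \<Omega>"
        using gen[OF i] i by (simp add: Frac_mult denoms_UNIV denoms_gen denoms.one)
      moreover have "Frac 1 (1 + var_poly i ^ 2) * Frac 1 (1 + var_poly i ^ 2) \<in> C_alg \<Omega>"
        using i by (intro C_closed Frac_one_in_C_alg denoms_gen)
      ultimately show "x \<in> ?H" using x H[OF denoms_gen[OF i]] by (elim insertE) simp_all
    qed
    show "real_subalgebra ?H"
      unfolding real_subalgebra_def
    proof (intro conjI ballI subspaceI)
      show "0 \<in> ?H" "1 \<in> ?H"
        by (rule H[OF denoms.one]; simp add: C_closed Frac_1)+
    next
      fix a b assume "a \<in> ?H" "b \<in> ?H"
      then obtain s t where *: "s \<in> denoms \<Omega>" "Frac 1 s * a \<in> C_alg \<Omega>"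
        "t \<in> denoms \<Omega>" "Frac 1 t * b \<in> C_alg \<Omega>" by blast
      have "Frac 1 (s * t) * (a + b) = Frac 1 t * (Frac 1 s * a) + Frac 1 s * (Frac 1 t * b)"
        "Frac 1 (s * t) * (a * b) = (Frac 1 s * a) * (Frac 1 t * b)"
        unfolding split[OF *(1,3)] by (simp_all add: algebra_simps)
      then have "Frac 1 (s * t) * (a + b) \<in> C_alg \<Omega>" "Frac 1 (s * t) * (a * b) \<in> C_alg \<Omega>"
        using * by (simp_all add: C_closed Frac_one_in_C_alg)
      moreover have "s * t \<in> denoms \<Omega>" using * by (intro denoms_mult)
      ultimately show "a + b \<in> ?H" "a * b \<in> ?H" using H by simp_all
    next
      fix a c assume "a \<in> ?H"
      then obtain t where t: "t \<in> denoms \<Omega>" "Frac 1 t * a \<in> C_alg \<Omega>" by blast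
      then show "c *\<^sub>R a \<in> ?H" using H[OF t(1), of "c *\<^sub>R a"] C_closed(5)[OF t(2), of c] by simp
    qed
  qed
  then show ?thesis using assms that by blast
qed

lemma Frac_one_invertible_in_B_alg:
  assumes "t \<in> denoms \<Omega>"
  shows "Frac 1 t \<in> B_alg \<Omega>" "Frac t 1 \<in> B_alg \<Omega>" "Frac 1 t * Frac t 1 = 1"
  using assms by (auto intro!: B_algI polys_1 denoms.one denoms_polys Frac_inverse denoms_UNIV)

section \<open>Positivity of the weights 1/t and 1 - 1/t\<close>

text \<open>Nonnegativity of L against two weights separately says nothing about their product, so
  the induction tracks weights whose multiplication preserves such nonnegativity. Only additivity
  and nonnegativity on squares are asked of L, so that both PSD functionals and characters
  qualify.\<close>

lemma psd_weighted_square_nonneg: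
  assumes add: "\<And>a b. a \<in> B_alg \<Omega> \<Longrightarrow> b \<in> B_alg \<Omega> \<Longrightarrow> L (a + b) = L a + (L b :: real)"
    and sq: "\<And>h. h \<in> B_alg \<Omega> \<Longrightarrow> 0 \<le> L (h ^ 2)"
    and t: "t \<in> denoms \<Omega>" and h: "h \<in> B_alg \<Omega>"
  shows "0 \<le> L (h ^ 2 * (Frac 1 t ^ i * (1 - Frac 1 t) ^ j))"
proof -
  \<comment> \<open>The multipliers \<open>M\<close> of the cone \<open>P\<close> are closed under sums and products and contain all squares.\<close>
  define P where "P = {a \<in> B_alg \<Omega>. \<forall>h\<in>B_alg \<Omega>. 0 \<le> L (h ^ 2 * a)}"
  define M where "M = {a \<in> B_alg \<Omega>. \<forall>b\<in>P. a * b \<in> P}"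
  have M_sq: "b ^ 2 \<in> M" if "b \<in> B_alg \<Omega>" for b
  proof -
    have "b ^ 2 * a \<in> P" if a: "a \<in> P" for a
    proof -
      have "0 \<le> L (g ^ 2 * (b ^ 2 * a))" if "g \<in> B_alg \<Omega>" for g
      proof -
        have "0 \<le> L ((g * b) ^ 2 * a)" using a that \<open>b \<in> B_alg \<Omega>\<close> by (auto simp: P_def B_closed)
        then show ?thesis by (simp add: power_mult_distrib mult.assoc)
      qed
      then show ?thesis using a that \<open>b \<in> B_alg \<Omega>\<close> by (auto simp: P_def B_closed)
    qed
    then show ?thesis using that by (auto simp: M_def B_closed)
  qed
  have P_add: "a + b \<in> P" if "a \<in> P" "b \<in> P" for a b
    using that by (auto simp: P_def distrib_left add B_closed)
  have M_add: "a + b \<in> M" if "a \<in> M" "b \<in> M" for a b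
    using that by (auto simp: M_def distrib_right P_add B_closed)
  have M_mult: "a * b \<in> M" if "a \<in> M" "b \<in> M" for a b
    using that by (auto simp: M_def mult.assoc B_closed)
  have M_1: "1 \<in> M" and M_0: "0 \<in> M" using M_sq[of 1] M_sq[of 0] B_closed(1,2)[of \<Omega>] by simp_all
  have M_pow: "a ^ n \<in> M" if "a \<in> M" for a n
    by (induction n) (auto simp: M_1 M_mult that)
  have "Frac 1 t \<in> M \<and> 1 - Frac 1 t \<in> M"
    using t
  proof induction
    case one
    then show ?case by (simp add: Frac_1 M_1 M_0)
  next
    case (mult s i)
    let ?y = "Frac 1 (1 + var_poly i ^ 2)" and ?z = "Frac (var_poly i) (1 + var_poly i ^ 2)"
    have yz: "?y \<in> B_alg \<Omega>" "?z \<in> B_alg \<Omega>"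
      using mult by (auto intro!: B_algI polys_1 polys_var denoms_gen)
    have y: "?y \<in> M" "1 - ?y \<in> M"
      using M_add[OF M_sq[OF yz(1)] M_sq[OF yz(2)]]
        M_add[OF M_sq[OF yz(2)] M_sq[of "1 - ?y"]] yz
      by (simp_all add: Frac_generators[symmetric] B_closed)
    have eq: "Frac 1 (s * (1 + var_poly i ^ 2)) = Frac 1 s * ?y"
      using mult by (simp add: Frac_mult denoms_UNIV denoms_gen)
    \<comment> \<open>This splitting passes from s to the next denominator with sums and products
      only, the operations under which M is closed.\<close>
    have eq': "1 - Frac 1 s * ?y = (1 - Frac 1 s) + Frac 1 s * (1 - ?y)" by (simp add: algebra_simps)
    show ?case unfolding eq eq' using mult y by (intro conjI M_add M_mult) auto
  qed
  then have "Frac 1 t ^ i * (1 - Frac 1 t) ^ j \<in> M" by (simp add: M_pow M_mult)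
  moreover have "1 \<in> P" using sq by (auto simp: P_def B_closed)
  ultimately have "Frac 1 t ^ i * (1 - Frac 1 t) ^ j * 1 \<in> P" unfolding M_def by blast
  then show ?thesis using h by (simp add: P_def)
qed

lemma psd_functionalD:
  assumes "psd_functional D L"
  shows "a \<in> D \<Longrightarrow> b \<in> D \<Longrightarrow> L (a + b) = L a + L b" "a \<in> D \<Longrightarrow> L (c *\<^sub>R a) = c * L a"
    "h \<in> D \<Longrightarrow> 0 \<le> L (h ^ 2)"
proof -
  assume "h \<in> D"
  have "\<forall>(n::nat) f. (\<forall>k<n. f k \<in> D) \<longrightarrow> 0 \<le> L (\<Sum>k<n. f k ^ 2)"
    using assms by (simp add: psd_functional_def)
  from this[rule_format, of 1 "\<lambda>_. h"] \<open>h \<in> D\<close> show "0 \<le> L (h ^ 2)" by simp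
qed (use assms in \<open>auto simp: psd_functional_def\<close>)

text \<open>A character is additive and nonnegative on squares, so the positivity lemma applies to
  it with h = 1. The lower bound is strict because 1/t is invertible in B.\<close>

lemma character_Frac_one_bounds:
  assumes \<alpha>: "\<alpha> \<in> characters (B_alg \<Omega>)" and t: "t \<in> denoms \<Omega>"
  shows "0 < \<alpha> (Frac 1 t)" "\<alpha> (Frac 1 t) \<le> 1"
proof -
  note D = characterD[OF real_subalgebra_B_alg \<alpha>]
  note F = Frac_one_invertible_in_B_alg[OF t]
  have 0: "0 \<le> \<alpha> (1 ^ 2 * (Frac 1 t ^ i * (1 - Frac 1 t) ^ j))" for i j
    by (rule psd_weighted_square_nonneg[OF _ _ t]) (auto simp: D B_closed)
  have "0 \<le> \<alpha> (Frac 1 t)" "\<alpha> (Frac 1 t) \<le> 1"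
    using 0[of 1 0] 0[of 0 1] F by (simp_all add: D B_closed)
  moreover have "\<alpha> (Frac 1 t) * \<alpha> (Frac t 1) = 1" using D(4)[OF F(1,2)] F(3) D(1) by simp
  then have "\<alpha> (Frac 1 t) \<noteq> 0" by auto
  ultimately show "0 < \<alpha> (Frac 1 t)" "\<alpha> (Frac 1 t) \<le> 1" by simp_all
qed

section \<open>The compact space of characters of \<open>C\<close>\<close>

lemma continuous_on_component [continuous_intros]: "continuous_on S (\<lambda>f. f i)"
  by (rule continuous_on_product_then_coordinatewise) (rule continuous_on_id)

text \<open>Membership, including the value \<open>undefined\<close> off D, is a family of equations
  between continuous functions of finitely many coordinates each.\<close>

lemma closed_characters: "closed (characters D)"
proof -
  have "characters D = {\<alpha>. (\<forall>a. a \<notin> D \<longrightarrow> \<alpha> a = undefined) \<and> \<alpha> 1 = 1 \<and>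
      (\<forall>a. a \<in> D \<longrightarrow> (\<forall>b. b \<in> D \<longrightarrow> \<alpha> (a + b) = \<alpha> a + \<alpha> b \<and> \<alpha> (a * b) = \<alpha> a * \<alpha> b))}"
    by (auto simp: characters_def extensional_def)
  also have "closed \<dots>"
    by (intro closed_Collect_conj closed_Collect_all closed_Collect_imp open_Collect_const
        closed_Collect_eq continuous_intros)
  finally show ?thesis .
qed

text \<open>Uniformly bounded elements form a subalgebra, and the circle equation bounds both
  generators by 1.\<close>

lemma C_alg_bounded:
  fixes \<Omega> :: "'i set"
  assumes "a \<in> C_alg \<Omega>"
  shows "\<exists>M. \<forall>\<alpha>\<in>characters (C_alg \<Omega>). \<bar>\<alpha> a\<bar> \<le> M"
proof -
  let ?A = "{a \<in> C_alg \<Omega>. \<exists>M. \<forall>\<alpha>\<in>characters (C_alg \<Omega>). \<bar>\<alpha> a\<bar> \<le> M}"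
  note D = characterD[OF real_subalgebra_C_alg]
  have A: "a \<in> ?A" if "a \<in> C_alg \<Omega>" "\<And>\<alpha>. \<alpha> \<in> characters (C_alg \<Omega>) \<Longrightarrow> \<bar>\<alpha> a\<bar> \<le> M" for a M
    using that by blast
  have "C_alg \<Omega> \<subseteq> ?A"
  proof -
    have "real_subalgebra hull (\<Union>i\<in>\<Omega>. {Frac 1 (1 + var_poly i ^ 2), Frac (var_poly i) (1 + var_poly i ^ 2)}) \<subseteq> ?A"
    proof (rule hull_minimal)
      show "(\<Union>i\<in>\<Omega>. {Frac 1 (1 + var_poly i ^ 2), Frac (var_poly i) (1 + var_poly i ^ 2)}) \<subseteq> ?A"
      proof (intro UN_least subsetI)
        fix i :: 'i and x
        let ?y = "Frac 1 (1 + var_poly i ^ 2)" and ?z = "Frac (var_poly i) (1 + var_poly i ^ 2)"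
        assume i: "i \<in> \<Omega>" and x: "x \<in> {?y, ?z}"
        have yz: "?y \<in> C_alg \<Omega>" "?z \<in> C_alg \<Omega>"
          unfolding C_alg_def using i by (intro hull_inc; auto)+
        have "\<bar>\<alpha> x\<bar> \<le> 1" if \<alpha>: "\<alpha> \<in> characters (C_alg \<Omega>)" for \<alpha>
        proof -
          have eq: "\<alpha> ?y = (\<alpha> ?y)\<^sup>2 + (\<alpha> ?z)\<^sup>2"
            using arg_cong[OF Frac_generators(1)[of i], of \<alpha>] yz by (simp add: D[OF \<alpha>] C_closed)
          then have "0 \<le> \<alpha> ?y" by (metis sum_power2_ge_zero)
          \<comment> \<open>A value of y above 1 would be smaller than its square, against y = y^2 +
            z^2.\<close>
          moreover have "\<alpha> ?y \<le> 1"
          proof (rule ccontr)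
            assume "\<not> \<alpha> ?y \<le> 1"
            then have "(\<alpha> ?y) ^ 1 < (\<alpha> ?y)\<^sup>2" by (intro power_strict_increasing) auto
            then show False using eq zero_le_power2[of "\<alpha> ?z"] unfolding power_one_right by linarith
          qed
          moreover from this have "(\<alpha> ?z)\<^sup>2 \<le> 1" using eq zero_le_power2[of "\<alpha> ?y"] by linarith
          then have "\<bar>\<alpha> ?z\<bar> \<le> 1" by (simp add: abs_square_le_1)
          ultimately show ?thesis using x by auto
        qed
        moreover have "x \<in> C_alg \<Omega>" using x yz by auto
        ultimately show "x \<in> ?A" by (rule A[rotated])
      qed
      show "real_subalgebra ?A"
        unfolding real_subalgebra_def
      proof (intro conjI ballI subspaceI)
        show "0 \<in> ?A" by (rule A[of _ 0]) (auto simp: D C_closed)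
        show "1 \<in> ?A" by (rule A[of _ 1]) (auto simp: D C_closed)
      next
        fix a b assume "a \<in> ?A" "b \<in> ?A"
        then obtain M N where *: "a \<in> C_alg \<Omega>" "b \<in> C_alg \<Omega>"
          "\<And>\<alpha>. \<alpha> \<in> characters (C_alg \<Omega>) \<Longrightarrow> \<bar>\<alpha> a\<bar> \<le> M"
          "\<And>\<alpha>. \<alpha> \<in> characters (C_alg \<Omega>) \<Longrightarrow> \<bar>\<alpha> b\<bar> \<le> N" by blast
        show "a + b \<in> ?A"
        proof (rule A[of _ "M + N"])
          fix \<alpha> assume \<alpha>: "\<alpha> \<in> characters (C_alg \<Omega>)"
          show "\<bar>\<alpha> (a + b)\<bar> \<le> M + N"
            using *(3)[OF \<alpha>] *(4)[OF \<alpha>] by (simp add: D(3)[OF \<alpha> *(1,2)])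
        qed (use * in \<open>simp add: C_closed\<close>)
        show "a * b \<in> ?A"
        proof (rule A[of _ "M * N"])
          fix \<alpha> assume \<alpha>: "\<alpha> \<in> characters (C_alg \<Omega>)"
          have "\<bar>\<alpha> a\<bar> * \<bar>\<alpha> b\<bar> \<le> M * N"
            using *(3)[OF \<alpha>] *(4)[OF \<alpha>] by (intro mult_mono) auto
          then show "\<bar>\<alpha> (a * b)\<bar> \<le> M * N" by (simp add: D(4)[OF \<alpha> *(1,2)] abs_mult)
        qed (use * in \<open>simp add: C_closed\<close>)
      next
        fix a c assume "a \<in> ?A"
        then obtain M where *: "a \<in> C_alg \<Omega>"
          "\<And>\<alpha>. \<alpha> \<in> characters (C_alg \<Omega>) \<Longrightarrow> \<bar>\<alpha> a\<bar> \<le> M" by blast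
        show "c *\<^sub>R a \<in> ?A"
        proof (rule A[of _ "\<bar>c\<bar> * M"])
          fix \<alpha> assume \<alpha>: "\<alpha> \<in> characters (C_alg \<Omega>)"
          show "\<bar>\<alpha> (c *\<^sub>R a)\<bar> \<le> \<bar>c\<bar> * M"
            using *(2)[OF \<alpha>] by (simp add: D(7)[OF \<alpha> *(1)] abs_mult mult_left_mono)
        qed (use * in \<open>simp add: C_closed\<close>)
      qed
    qed
    then show ?thesis by (simp only: C_alg_def[symmetric])
  qed
  then show ?thesis using assms by blast
qed

text \<open>Tychonoff: the characters are closed in a product of compact intervals. Coordinates
  outside C get the one-point factor \<open>{undefined}\<close>, which makes the product over the
  whole type compact.\<close>

lemma compact_characters_C_alg: "compact (characters (C_alg \<Omega>))"
proof -
  obtain M where M: "\<And>a \<alpha>. a \<in> C_alg \<Omega> \<Longrightarrow> \<alpha> \<in> characters (C_alg \<Omega>) \<Longrightarrow> \<bar>\<alpha> a\<bar> \<le> M a"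
    using C_alg_bounded by metis
  define S where "S a = (if a \<in> C_alg \<Omega> then {- M a..M a} else {undefined :: real})" for a
  have "compactin (product_topology (\<lambda>_. euclidean) UNIV) (PiE UNIV S)"
    unfolding compactin_PiE by (auto simp: S_def)
  then have "compact (PiE UNIV S)" by (simp add: euclidean_product_topology)
  moreover have "characters (C_alg \<Omega>) \<subseteq> PiE UNIV S"
  proof
    fix \<alpha> assume \<alpha>: "\<alpha> \<in> characters (C_alg \<Omega>)"
    then have "\<alpha> a = undefined" if "a \<notin> C_alg \<Omega>" for a
      using that by (auto simp: characters_def extensional_def)
    then show "\<alpha> \<in> PiE UNIV S" using M[OF _ \<alpha>] by (auto simp: S_def abs_le_iff minus_le_iff)
  qed
  ultimately show ?thesis
    using compact_Int_closed[OF _ closed_characters] by (metis inf.absorb_iff2 inf_commute)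
qed

text \<open>Ring members only have to agree with an evaluation on characters. Literal evaluations
  would not be closed under sums, as \<open>\<alpha> a + \<alpha> b\<close> equals
  \<open>\<alpha> (a + b)\<close> only for additive \<open>\<alpha>\<close>.\<close>

lemma function_ring_on_characters:
  assumes D: "real_subalgebra D" and "compact (characters D)"
  shows "function_ring_on {f. \<exists>a\<in>D. \<forall>\<alpha>\<in>characters D. f \<alpha> = \<alpha> a} (characters D)"
proof
  note cl = real_subalgebraD[OF D] and ch = characterD[OF D]
  let ?R = "{f. \<exists>a\<in>D. \<forall>\<alpha>\<in>characters D. f \<alpha> = \<alpha> a}"
  show "compact (characters D)" by fact
  show "continuous_on (characters D) f" if f: "f \<in> ?R" for f
  proof -
    obtain a where "\<forall>\<alpha>\<in>characters D. f \<alpha> = \<alpha> a" using f by blast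
    then show ?thesis by (subst continuous_on_cong[OF refl]) (auto intro: continuous_on_component)
  qed
  show "(\<lambda>x. f x + g x) \<in> ?R" "(\<lambda>x. f x * g x) \<in> ?R" if fg: "f \<in> ?R" "g \<in> ?R" for f g
  proof -
    obtain a b where *: "a \<in> D" "\<forall>\<alpha>\<in>characters D. f \<alpha> = \<alpha> a" "b \<in> D" "\<forall>\<alpha>\<in>characters D. g \<alpha> = \<alpha> b"
      using fg by blast
    show "(\<lambda>x. f x + g x) \<in> ?R"
      using * by (intro CollectI bexI[of _ "a + b"]) (simp_all add: ch cl)
    show "(\<lambda>x. f x * g x) \<in> ?R"
      using * by (intro CollectI bexI[of _ "a * b"]) (simp_all add: ch cl)
  qed
  show "(\<lambda>_. c) \<in> ?R" for c
    by (intro CollectI bexI[of _ "c *\<^sub>R 1"]) (simp_all add: ch cl)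
  show "\<exists>f\<in>?R. f x \<noteq> f y" if xy: "x \<in> characters D" "y \<in> characters D" "x \<noteq> y" for x y
  proof -
    obtain a where a: "a \<in> D" "x a \<noteq> y a"
      using xy extensionalityI[of x D y] unfolding characters_def by blast
    then show ?thesis by (intro bexI[of _ "\<lambda>\<alpha>. \<alpha> a"]) auto
  qed
qed

section \<open>Restriction of characters\<close>

text \<open>The right-hand side sees only the restriction of \<open>\<alpha>\<close> to C. This
  yields injectivity of restriction and an explicit formula for its inverse.\<close>

lemma character_eq_quotient:
  assumes \<alpha>: "\<alpha> \<in> characters (B_alg \<Omega>)" and b: "b \<in> B_alg \<Omega>"
    and t: "t \<in> denoms \<Omega>" "Frac 1 t * b \<in> C_alg \<Omega>"
  shows "\<alpha> b = res_C \<Omega> \<alpha> (Frac 1 t * b) / res_C \<Omega> \<alpha> (Frac 1 t)"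
    "res_C \<Omega> \<alpha> (Frac 1 t) \<noteq> 0"
  using character_Frac_one_bounds[OF \<alpha> t(1)] t Frac_one_in_C_alg[OF t(1)]
    Frac_one_invertible_in_B_alg(1)[OF t(1)] b
  by (auto simp: res_C_def characterD[OF real_subalgebra_B_alg \<alpha>])

lemma res_C_homeomorphism:
  "homeomorphism (characters (B_alg \<Omega>)) (res_C \<Omega> ` characters (B_alg \<Omega>)) (res_C \<Omega>)
     (inv_into (characters (B_alg \<Omega>)) (res_C \<Omega>))"
proof (rule homeomorphismI)
  let ?X = "characters (B_alg \<Omega>)" and ?r = "res_C \<Omega>"
  let ?e = "inv_into ?X ?r"
  have inj: "inj_on ?r ?X"
  proof (rule inj_onI)
    fix \<alpha> \<beta> assume *: "\<alpha> \<in> ?X" "\<beta> \<in> ?X" "?r \<alpha> = ?r \<beta>"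
    have "\<alpha> b = \<beta> b" if "b \<in> B_alg \<Omega>" for b
      using B_alg_common_denominator[OF that]
      by (metis * that character_eq_quotient(1))
    then show "\<alpha> = \<beta>" using * by (auto simp: characters_def intro: extensionalityI)
  qed
  show "?r ` ?X \<subseteq> ?r ` ?X" "?e ` ?r ` ?X \<subseteq> ?X" by (auto simp: inv_into_into)
  show "?e (?r \<alpha>) = \<alpha>" if "\<alpha> \<in> ?X" for \<alpha> using inj that by simp
  show "?r (?e \<beta>) = \<beta>" if "\<beta> \<in> ?r ` ?X" for \<beta> using that by (rule f_inv_into_f)
  show "continuous_on ?X ?r"
  proof (rule continuous_on_coordinatewise_then_product)
    fix a
    show "continuous_on ?X (\<lambda>\<alpha>. ?r \<alpha> a)"
      by (cases "a \<in> C_alg \<Omega>") (auto simp: res_C_def intro: continuous_intros)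
  qed
  show "continuous_on (?r ` ?X) ?e"
  proof (rule continuous_on_coordinatewise_then_product)
    fix b
    show "continuous_on (?r ` ?X) (\<lambda>\<beta>. ?e \<beta> b)"
    proof (cases "b \<in> B_alg \<Omega>")
      case True
      then obtain t where t: "t \<in> denoms \<Omega>" "Frac 1 t * b \<in> C_alg \<Omega>"
        by (rule B_alg_common_denominator)
      \<comment> \<open>The denominator t depends on b alone, so a single quotient of two
        coordinates describes \<open>?e \<beta> b\<close> on the entire image.\<close>
      have "continuous_on (?r ` ?X) (\<lambda>\<beta>. \<beta> (Frac 1 t * b) / \<beta> (Frac 1 t))"
        using character_eq_quotient(2)[OF _ True t] by (intro continuous_intros) auto
      moreover have "?e \<beta> b = \<beta> (Frac 1 t * b) / \<beta> (Frac 1 t)" if "\<beta> \<in> ?r ` ?X" for \<beta>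
        using that inj character_eq_quotient(1)[OF _ True t] by auto
      ultimately show ?thesis by (simp cong: continuous_on_cong)
    next
      case False
      have "?e \<beta> b = undefined" if "\<beta> \<in> ?r ` ?X" for \<beta>
        using inv_into_into[OF that] False by (auto simp: characters_def extensional_def)
      then show ?thesis by (simp cong: continuous_on_cong)
    qed
  qed
qed

section \<open>Extending a representation from \<open>C\<close> to \<open>B\<close>\<close>

text \<open>Every character is 1 at 1, so integrability of that evaluation is finiteness of the
  total mass.\<close>

lemma represents_finite_measure:
  assumes "represents M D L" "space M = characters D" "1 \<in> D"
  shows "finite_measure M"
proof (rule finite_measureI)
  have "integrable M (\<lambda>\<alpha>. \<alpha> 1)" using assms by (auto simp: represents_def has_bochner_integral_iff)
  moreover have "integrable M (\<lambda>\<alpha>. \<alpha> 1) \<longleftrightarrow> integrable M (indicator (space M) :: _ \<Rightarrow> real)"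
    using assms by (intro Bochner_Integration.integrable_cong) (auto simp: characters_def)
  ultimately show "emeasure M (space M) \<noteq> \<infinity>" by (simp add: integrable_indicator_iff)
qed

lemma tendsto_psd_square_truncation:
  assumes L: "psd_functional (B_alg \<Omega>) L" and t: "t \<in> denoms \<Omega>" and h: "h \<in> B_alg \<Omega>"
  shows "(\<lambda>n. L (h ^ 2 * (1 - (1 - Frac 1 t) ^ n))) \<longlonglongrightarrow> L (h ^ 2)"
proof -
  note P = psd_functionalD[OF L] and F = Frac_one_invertible_in_B_alg[OF t]
  define d s where "d = Frac 1 t" and "s = Frac t 1"
  have ds: "d \<in> B_alg \<Omega>" "s \<in> B_alg \<Omega>" "d * s = 1" using F by (simp_all add: d_def s_def)
  define A where "A n = L (h ^ 2 * (1 - d) ^ n)" for n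
  \<comment> \<open>With s = 1/d, the weight \<open>s * (1 - d) ^ n\<close> is the closed form of
    the geometric tail of all (1-d)^k with k at least n; so \<open>S n\<close> plays the tail of the
    series of the \<open>A k\<close>.\<close>
  define S where "S n = L (h ^ 2 * (s * (1 - d) ^ n))" for n
  have pos: "0 \<le> L (g ^ 2 * (d ^ i * (1 - d) ^ j))" if "g \<in> B_alg \<Omega>" for g i j
    unfolding d_def by (rule psd_weighted_square_nonneg[OF P(1,3) t that])
  have A_nonneg: "0 \<le> A n" for n using pos[OF h, of 0 n] by (simp add: A_def)
  \<comment> \<open>Writing s as s^2 d turns the tail into a weighted square, so the positivity
    lemma applies.\<close>
  have "h ^ 2 * (s * (1 - d) ^ n) = (h * s) ^ 2 * (d ^ 1 * (1 - d) ^ n)" for n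
  proof -
    have "(h * s) ^ 2 * (d ^ 1 * (1 - d) ^ n) = h ^ 2 * ((d * s) * s * (1 - d) ^ n)"
      by (simp add: power2_eq_square mult_ac)
    then show ?thesis by (simp add: ds)
  qed
  then have S_nonneg: "0 \<le> S n" for n using pos[of "h * s" 1 n] h ds by (simp add: S_def B_closed)
  have A_Suc: "A (Suc n) \<le> A n" for n
  proof -
    have "A n = A (Suc n) + L (h ^ 2 * (d ^ 1 * (1 - d) ^ n))"
      unfolding A_def using h ds
      by (subst P(1)[symmetric]) (auto simp: B_closed algebra_simps)
    then show ?thesis using pos[OF h, of 1 n] by simp
  qed
  have S_Suc: "S n = S (Suc n) + A n" for n
  proof -
    have "s * (1 - d) ^ n = s * (1 - d) ^ Suc n + (d * s) * (1 - d) ^ n" by (simp add: algebra_simps)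
    then have "h ^ 2 * (s * (1 - d) ^ n) = h ^ 2 * (s * (1 - d) ^ Suc n) + h ^ 2 * (1 - d) ^ n"
      by (simp add: ds distrib_left)
    then show ?thesis unfolding A_def S_def using h ds by (simp add: P(1) B_closed del: power_Suc)
  qed
  \<comment> \<open>Keeping the tail \<open>S n\<close> on the left makes the induction telescope:
    \<open>S\<close> drops by \<open>A n\<close> in each step, and \<open>A\<close>
    decreases.\<close>
  have "real n * A n + S n \<le> S 0" for n
  proof (induction n)
    case (Suc n)
    have "real (Suc n) * A (Suc n) \<le> real (Suc n) * A n" by (intro mult_left_mono A_Suc) simp
    then show ?case using Suc S_Suc[of n] by (simp add: algebra_simps)
  qed simp
  then have "real n * A n \<le> S 0" for n using S_nonneg[of n] by (smt (verit))
  then have A_le: "A n \<le> S 0 / real n" if "n > 0" for n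
    using that by (simp add: field_simps)
  have "A \<longlonglongrightarrow> 0"
  proof (rule tendsto_sandwich[of "\<lambda>_. 0" A _ "\<lambda>n. S 0 / real n"])
    show "(\<lambda>n. S 0 / real n) \<longlonglongrightarrow> 0" by (rule lim_const_over_n)
    show "\<forall>\<^sub>F n in sequentially. A n \<le> S 0 / real n"
      using eventually_gt_at_top[of 0] by eventually_elim (rule A_le)
  qed (use A_nonneg in auto)
  moreover have "L (h ^ 2 * (1 - (1 - d) ^ n)) = L (h ^ 2) - A n" for n
  proof -
    have "L (h ^ 2 * (1 - (1 - d) ^ n)) + A n = L (h ^ 2 * (1 - (1 - d) ^ n) + h ^ 2 * (1 - d) ^ n)"
      unfolding A_def using h ds by (intro P(1)[symmetric]) (auto simp: B_closed)
    then show ?thesis by (simp add: algebra_simps)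
  qed
  ultimately show ?thesis using tendsto_diff[OF tendsto_const, of A 0] by (simp add: d_def)
qed

text \<open>Elements of B may be unbounded, so integrability is part of the claim. For squares,
  monotone convergence delivers integrability and the value of the integral together; polarization
  then reaches all of B.\<close>

lemma represents_B_alg_of_C_alg:
  assumes L: "psd_functional (B_alg \<Omega>) L" and sp: "space N = characters (B_alg \<Omega>)"
    and meas: "\<And>b. b \<in> B_alg \<Omega> \<Longrightarrow> (\<lambda>\<alpha>. \<alpha> b) \<in> borel_measurable N"
    and N: "represents N (C_alg \<Omega>) L"
  shows "represents N (B_alg \<Omega>) L"
proof -
  note P = psd_functionalD[OF L] and D = characterD[OF real_subalgebra_B_alg]
  have square: "has_bochner_integral N (\<lambda>\<alpha>. \<alpha> (h ^ 2)) (L (h ^ 2))" if h: "h \<in> B_alg \<Omega>" for h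
  proof -
    obtain t where t: "t \<in> denoms \<Omega>" "Frac 1 t * h \<in> C_alg \<Omega>"
      using B_alg_common_denominator[OF h] .
    \<comment> \<open>A denominator t for h is squared, so that h^2 / u is the square of h / t and
      hence lies in C.\<close>
    define u where "u = t * t"
    have u: "u \<in> denoms \<Omega>" using t by (simp add: u_def denoms_mult)
    define d where "d = Frac 1 u"
    have dC: "d \<in> C_alg \<Omega>" using u by (simp add: d_def Frac_one_in_C_alg)
    then have dB: "d \<in> B_alg \<Omega>" using C_alg_subset_B_alg by blast
    have "h ^ 2 * d = (Frac 1 t * h) ^ 2"
      using t by (simp add: d_def u_def Frac_mult[of t t 1 1, simplified, symmetric] denoms_UNIV power2_eq_square mult_ac)
    then have hd: "h ^ 2 * d \<in> C_alg \<Omega>" using t by (simp add: C_closed)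
    define g where "g n = h ^ 2 * (1 - (1 - d) ^ n)" for n
    have gC: "g n \<in> C_alg \<Omega>" for n
    proof (induction n)
      case 0
      then show ?case by (simp add: g_def C_closed)
    next
      case (Suc n)
      \<comment> \<open>Each increment carries a factor h^2 d, which is in C even though h^2 itself
        may not be.\<close>
      have "g (Suc n) = g n + h ^ 2 * d * (1 - d) ^ n" by (simp add: g_def algebra_simps)
      then show ?case using Suc hd dC by (simp add: C_closed)
    qed
    have g_val: "\<alpha> (g n) = (\<alpha> h)\<^sup>2 * (1 - (1 - \<alpha> d) ^ n)" if "\<alpha> \<in> space N" for \<alpha> n
      using that h dB by (simp add: g_def sp D B_closed)
    have int: "has_bochner_integral N (\<lambda>\<alpha>. \<alpha> (g n)) (L (g n))" for n
      using N gC by (auto simp: represents_def)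
    have bounds: "0 \<le> 1 - \<alpha> d" "1 - \<alpha> d < 1" if "\<alpha> \<in> space N" for \<alpha>
      using character_Frac_one_bounds[OF _ u, of \<alpha>] that by (auto simp: sp d_def)
    show ?thesis
    proof (rule has_bochner_integral_monotone_convergence)
      show "integrable N (\<lambda>\<alpha>. \<alpha> (g n))" for n using int by (simp add: has_bochner_integral_iff)
      show "AE \<alpha> in N. mono (\<lambda>n. \<alpha> (g n))"
      proof (rule AE_I2, rule monoI)
        fix \<alpha> and m n :: nat assume "\<alpha> \<in> space N" "m \<le> n"
        then show "\<alpha> (g m) \<le> \<alpha> (g n)"
          using bounds[of \<alpha>] power_decreasing[of m n "1 - \<alpha> d"]
          by (simp add: g_val mult_left_mono)
      qed
      show "AE \<alpha> in N. (\<lambda>n. \<alpha> (g n)) \<longlonglongrightarrow> \<alpha> (h ^ 2)"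
      proof (rule AE_I2)
        fix \<alpha> assume \<alpha>: "\<alpha> \<in> space N"
        have "(\<lambda>n. (\<alpha> h)\<^sup>2 * (1 - (1 - \<alpha> d) ^ n)) \<longlonglongrightarrow> (\<alpha> h)\<^sup>2 * (1 - 0)"
          using bounds[OF \<alpha>] by (intro tendsto_intros LIMSEQ_power_zero) auto
        then show "(\<lambda>n. \<alpha> (g n)) \<longlonglongrightarrow> \<alpha> (h ^ 2)"
          using \<alpha> h by (simp add: g_val sp D)
      qed
      have "integral\<^sup>L N (\<lambda>\<alpha>. \<alpha> (g n)) = L (g n)" for n using int by (simp add: has_bochner_integral_iff)
      then show "(\<lambda>n. integral\<^sup>L N (\<lambda>\<alpha>. \<alpha> (g n))) \<longlonglongrightarrow> L (h ^ 2)"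
        using tendsto_psd_square_truncation[OF L u h] by (simp add: g_def d_def)
      show "(\<lambda>\<alpha>. \<alpha> (h ^ 2)) \<in> borel_measurable N" using h by (intro meas) (simp add: B_closed)
    qed
  qed
  show ?thesis
    unfolding represents_def
  proof
    fix b assume b: "b \<in> B_alg \<Omega>"
    \<comment> \<open>Polarization: 4 b is the difference of the squares of b + 1 and b - 1.\<close>
    let ?p = "b + 1" and ?q = "b - 1"
    have pq: "?p \<in> B_alg \<Omega>" "?q \<in> B_alg \<Omega>" using b by (simp_all add: B_closed)
    have eq: "?p ^ 2 = ?q ^ 2 + 4 *\<^sub>R b"
      by (simp add: power2_eq_square algebra_simps scaleR_conv_of_real)
    have L_eq: "L b = (L (?p ^ 2) - L (?q ^ 2)) / 4"
      unfolding eq using pq b by (simp add: P(1,2) B_closed)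
    have "has_bochner_integral N (\<lambda>\<alpha>. (\<alpha> (?p ^ 2) - \<alpha> (?q ^ 2)) / 4) (L b)"
      unfolding L_eq using pq by (intro has_bochner_integral_divide has_bochner_integral_diff square) auto
    moreover have "(\<alpha> (?p ^ 2) - \<alpha> (?q ^ 2)) / 4 = \<alpha> b" if "\<alpha> \<in> space N" for \<alpha>
      unfolding eq using that pq b by (simp add: sp D B_closed)
    ultimately show "has_bochner_integral N (\<lambda>\<alpha>. \<alpha> b) (L b)"
      by (simp cong: has_bochner_integral_cong)
  qed
qed

section \<open>Comparison of the measures\<close>

lemma pushforward_res_C:
  assumes N: "radon_measure (top_of_set (characters (B_alg \<Omega>))) N" "represents N (B_alg \<Omega>) L"
  defines "M \<equiv> distr N (restrict_space borel (characters (C_alg \<Omega>))) (res_C \<Omega>)"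
  shows "radon_measure (top_of_set (characters (C_alg \<Omega>))) M" "represents M (C_alg \<Omega>) L"
proof -
  note hom = res_C_homeomorphism[of \<Omega>] and DN = radon_measureD[OF N(1)]
  have img: "res_C \<Omega> ` characters (B_alg \<Omega>) \<subseteq> characters (C_alg \<Omega>)"
    using XB_in_XC_subset by (simp add: XB_in_XC_def)
  have cont: "continuous_on (characters (B_alg \<Omega>)) (res_C \<Omega>)"
    using hom by (simp add: homeomorphism_def)
  have fin: "finite_measure N"
    using represents_finite_measure[OF N(2) DN(1)] by (simp add: B_closed)
  show "radon_measure (top_of_set (characters (C_alg \<Omega>))) M"
    unfolding M_def using N(1) fin cont _ img
  proof (rule radon_measure_distr)
    show "inj_on (res_C \<Omega>) (characters (B_alg \<Omega>))"
      using hom by (auto simp: homeomorphism_def intro: inj_on_inverseI)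
  qed
  show "represents M (C_alg \<Omega>) L"
    unfolding represents_def M_def
  proof (intro ballI has_bochner_integral_distr)
    fix f assume f: "f \<in> C_alg \<Omega>"
    show "(\<lambda>\<alpha>. \<alpha> f) \<in> borel_measurable (restrict_space borel (characters (C_alg \<Omega>)))"
      by (intro borel_measurable_continuous_on_restrict continuous_on_component)
    show "res_C \<Omega> \<in> measurable N (restrict_space borel (characters (C_alg \<Omega>)))"
      using cont img DN by (intro continuous_on_measurable_restrict)
    show "has_bochner_integral N (\<lambda>\<alpha>. res_C \<Omega> \<alpha> f) (L f)"
      using N(2) f C_alg_subset_B_alg[of \<Omega>] by (auto simp: res_C_def represents_def)
  qed
qed

lemma radon_measure_representing_unique:
  assumes D: "real_subalgebra D" "compact (characters D)"
    and M: "radon_measure (top_of_set (characters D)) M" "represents M D L"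
    and N: "radon_measure (top_of_set (characters D)) N" "represents N D L"
  shows "M = N"
proof (rule radon_measure_eqI_ring[OF function_ring_on_characters[OF D]])
  have 1: "1 \<in> D" using real_subalgebraD[OF D(1)] by simp
  show "finite_measure M" "finite_measure N"
    using represents_finite_measure[OF M(2) radon_measureD(1)[OF M(1)] 1]
      represents_finite_measure[OF N(2) radon_measureD(1)[OF N(1)] 1] .
  fix f assume "f \<in> {f. \<exists>a\<in>D. \<forall>\<alpha>\<in>characters D. f \<alpha> = \<alpha> a}"
  then obtain a where a: "a \<in> D" "\<And>\<alpha>. \<alpha> \<in> characters D \<Longrightarrow> f \<alpha> = \<alpha> a" by blast
  have "has_bochner_integral M f (L a) \<longleftrightarrow> has_bochner_integral M (\<lambda>\<alpha>. \<alpha> a) (L a)"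
    by (rule has_bochner_integral_cong) (simp_all add: a radon_measureD(1)[OF M(1)])
  moreover have "has_bochner_integral N f (L a) \<longleftrightarrow> has_bochner_integral N (\<lambda>\<alpha>. \<alpha> a) (L a)"
    by (rule has_bochner_integral_cong) (simp_all add: a radon_measureD(1)[OF N(1)])
  ultimately show "\<exists>x. has_bochner_integral M f x \<and> has_bochner_integral N f x"
    using M(2) N(2) a by (auto simp: represents_def)
qed (fact M N)+

text \<open>The inverse of restriction is defined on \<open>XB_in_XC \<Omega>\<close>, which is not
  known to be measurable. Hence the measure is first cut down to the Borel set E, which carries all
  the mass, and only then moved to X(B).\<close>

lemma representing_measure_of_support:
  assumes L: "psd_functional (B_alg \<Omega>) L"
    and M: "radon_measure (top_of_set (characters (C_alg \<Omega>))) M" "represents M (C_alg \<Omega>) L"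
    and E: "E \<in> sets M" "E \<subseteq> XB_in_XC \<Omega>" "supported_by M E"
  shows "\<exists>N. radon_measure (top_of_set (characters (B_alg \<Omega>))) N \<and> represents N (B_alg \<Omega>) L"
proof -
  let ?X = "characters (B_alg \<Omega>)"
  define e where "e = inv_into ?X (res_C \<Omega>)"
  define N where "N = distr (restrict_space M E) (restrict_space borel ?X) e"
  note DM = radon_measureD[OF M(1)]
  have hom: "homeomorphism ?X (XB_in_XC \<Omega>) (res_C \<Omega>) e"
    unfolding e_def XB_in_XC_def by (rule res_C_homeomorphism)
  have e: "continuous_on E e" "inj_on e E" "e ` E \<subseteq> ?X"
    and re: "\<And>\<beta>. \<beta> \<in> E \<Longrightarrow> res_C \<Omega> (e \<beta>) = \<beta>"
    using hom E(2) by (auto simp: homeomorphism_def subset_iff intro: continuous_on_subset inj_on_inverseI[of _ "res_C \<Omega>"])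
  have finM: "finite_measure M" using represents_finite_measure[OF M(2) DM(1)] by (simp add: C_closed)
  have finE: "finite_measure (restrict_space M E)"
    using finM E(1) by (intro finite_measure_restrict_space) auto
  have radE: "radon_measure (top_of_set E) (restrict_space M E)"
    by (rule radon_measure_restrict) fact+
  have rad: "radon_measure (top_of_set ?X) N"
    unfolding N_def by (rule radon_measure_distr) fact+
  have AE: "AE \<beta> in M. \<beta> \<in> E"
  proof (rule AE_I')
    show "space M - E \<in> null_sets M"
      using E(1,3) by (auto simp: supported_by_def null_sets_def)
  qed auto
  have meas: "e \<in> measurable (restrict_space M E) (restrict_space borel ?X)"
    using e radon_measureD(2)[OF radE] by (intro continuous_on_measurable_restrict)
  have "represents N (C_alg \<Omega>) L"
    unfolding represents_def N_def
  proof (intro ballI has_bochner_integral_distr)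
    fix f assume f: "f \<in> C_alg \<Omega>"
    show "(\<lambda>\<alpha>. \<alpha> f) \<in> borel_measurable (restrict_space borel ?X)"
      by (intro borel_measurable_continuous_on_restrict continuous_on_component)
    have int: "has_bochner_integral M (\<lambda>\<beta>. \<beta> f) (L f)" using M(2) f by (simp add: represents_def)
    \<comment> \<open>Multiplying by the indicator changes nothing almost everywhere and gives the
      form in which integrals over \<open>restrict_space M E\<close> are computed.\<close>
    have "has_bochner_integral M (\<lambda>\<beta>. indicator E \<beta> *\<^sub>R \<beta> f) (L f)"
    proof (rule has_bochner_integral_cong_AE[THEN iffD1, OF _ _ _ int])
      show "AE \<beta> in M. \<beta> f = indicator E \<beta> *\<^sub>R \<beta> f" using AE by eventually_elim simp
      show m: "(\<lambda>\<beta>. \<beta> f) \<in> borel_measurable M" using int by (auto simp: has_bochner_integral_iff)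
      show "(\<lambda>\<beta>. indicator E \<beta> *\<^sub>R \<beta> f) \<in> borel_measurable M"
        using m E(1) by (intro borel_measurable_scaleR borel_measurable_indicator)
    qed
    then have "has_bochner_integral (restrict_space M E) (\<lambda>\<beta>. \<beta> f) (L f)"
      using E(1) by (simp add: has_bochner_integral_iff integrable_restrict_space integral_restrict_space)
    moreover have "has_bochner_integral (restrict_space M E) (\<lambda>\<beta>. e \<beta> f) (L f) \<longleftrightarrow>
        has_bochner_integral (restrict_space M E) (\<lambda>\<beta>. \<beta> f) (L f)"
    proof (rule has_bochner_integral_cong)
      fix \<beta> assume "\<beta> \<in> space (restrict_space M E)"
      then have "res_C \<Omega> (e \<beta>) = \<beta>" using re radon_measureD(1)[OF radE] by simp
      then show "e \<beta> f = \<beta> f" using f by (metis res_C_def restrict_apply')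
    qed simp_all
    ultimately show "has_bochner_integral (restrict_space M E) (\<lambda>\<beta>. e \<beta> f) (L f)" by simp
  qed (rule meas)
  moreover have "(\<lambda>\<alpha>. \<alpha> b) \<in> borel_measurable N" for b
    unfolding N_def measurable_distr_eq1
    by (intro borel_measurable_continuous_on_restrict continuous_on_component)
  ultimately have "represents N (B_alg \<Omega>) L"
    using represents_B_alg_of_C_alg[OF L radon_measureD(1)[OF rad]] by simp
  then show ?thesis using rad by blast
qed

text \<open>The supremum is already reached along countably many compact sets. Their union is Borel,
  lies in Y and has full mass; finiteness makes its complement null.\<close>

lemma support_of_SUP_compact:
  fixes S Y :: "'a::t2_space set"
  assumes M: "radon_measure (top_of_set S) M" "finite_measure M"
    and Y: "Y \<subseteq> S" and eq: "emeasure M S = (SUP K\<in>{K. compact K \<and> K \<subseteq> Y}. emeasure M K)"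
  shows "\<exists>E\<in>sets M. E \<subseteq> Y \<and> supported_by M E"
proof -
  interpret finite_measure M by fact
  note D = radon_measureD[OF M(1)]
  have "{K. compact K \<and> K \<subseteq> Y} \<noteq> {}" by auto
  then obtain f :: "nat \<Rightarrow> ennreal" where f: "range f \<subseteq> emeasure M ` {K. compact K \<and> K \<subseteq> Y}"
    "(SUP K\<in>{K. compact K \<and> K \<subseteq> Y}. emeasure M K) = (SUP n. f n)"
    using ennreal_SUP_countable_SUP[of "{K. compact K \<and> K \<subseteq> Y}" "emeasure M"] by blast
  then have "\<forall>n. \<exists>K. compact K \<and> K \<subseteq> Y \<and> f n = emeasure M K" by blast
  then obtain K where K: "\<And>n. compact (K n)" "\<And>n. K n \<subseteq> Y" "\<And>n. f n = emeasure M (K n)" by metis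
  define E where "E = (\<Union>n. K n)"
  have "K n \<in> sets M" for n using K Y D by (metis compact_in_restrict_borel order_trans)
  then have E: "E \<in> sets M" by (auto simp: E_def)
  have "emeasure M (space M) \<le> emeasure M E"
    unfolding D(1) eq f(2) K(3) using E by (intro SUP_least emeasure_mono) (auto simp: E_def)
  then have "emeasure M (space M - E) = 0"
    using E by (simp add: emeasure_compl diff_eq_0_ennreal less_top[symmetric])
  moreover have "emeasure M F \<le> emeasure M (space M - E)" if "F \<in> sets M" "F \<inter> E = {}" for F
    using that E sets.sets_into_space by (intro emeasure_mono) auto
  ultimately have "supported_by M E" by (auto simp: supported_by_def)
  moreover have "E \<subseteq> Y" using K by (auto simp: E_def)
  ultimately show ?thesis using E by blast
qed

theorem proposition3p6:
  fixes \<Omega> :: "'i set"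
    and L :: "'i bfrac \<Rightarrow> real"
    and \<mu> :: "('i bfrac \<Rightarrow> real) measure"
  assumes "psd_functional (B_alg \<Omega>) L"
    and "radon_measure (X_top (C_alg \<Omega>)) \<mu>"
    and "represents \<mu> (C_alg \<Omega>) L"
  shows "((\<exists>\<nu>. radon_measure (X_top (B_alg \<Omega>)) \<nu> \<and> represents \<nu> (B_alg \<Omega>) L) \<longleftrightarrow>
      (\<forall>E\<in>borel_sets (X_top (C_alg \<Omega>)). emeasure \<mu> E =
        (SUP K\<in>{K. compactin (X_top (C_alg \<Omega>)) K \<and> K \<subseteq> XB_in_XC \<Omega> \<inter> E}. emeasure \<mu> K))) \<and>
    ((\<exists>\<nu>. radon_measure (X_top (B_alg \<Omega>)) \<nu> \<and> represents \<nu> (B_alg \<Omega>) L) \<longleftrightarrow>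
      emeasure \<mu> (topspace (X_top (C_alg \<Omega>))) =
        (SUP K\<in>{K. compactin (X_top (C_alg \<Omega>)) K \<and> K \<subseteq> XB_in_XC \<Omega>}. emeasure \<mu> K)) \<and>
    ((\<exists>\<nu>. radon_measure (X_top (B_alg \<Omega>)) \<nu> \<and> represents \<nu> (B_alg \<Omega>) L) \<longleftrightarrow>
      (\<exists>E\<in>borel_sets (X_top (C_alg \<Omega>)). E \<subseteq> XB_in_XC \<Omega> \<and> supported_by \<mu> E)) \<and>
    (\<forall>\<nu>. radon_measure (X_top (B_alg \<Omega>)) \<nu> \<and> represents \<nu> (B_alg \<Omega>) L \<longrightarrow>
      (\<forall>E\<in>borel_sets (X_top (B_alg \<Omega>)). emeasure \<nu> E =
        (SUP K\<in>{K. compactin (X_top (C_alg \<Omega>)) K \<and> K \<subseteq> res_C \<Omega> ` E}. emeasure \<mu> K))) \<and>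
    ((\<exists>\<nu>. radon_measure (X_top (B_alg \<Omega>)) \<nu> \<and> represents \<nu> (B_alg \<Omega>) L) \<longrightarrow>
      (\<exists>!\<nu>. radon_measure (X_top (B_alg \<Omega>)) \<nu> \<and> represents \<nu> (B_alg \<Omega>) L))"
proof -
  let ?XB = "characters (B_alg \<Omega>)" and ?XC = "characters (C_alg \<Omega>)"
  have topB: "X_top (B_alg \<Omega>) = top_of_set ?XB" and topC: "X_top (C_alg \<Omega>) = top_of_set ?XC"
    by (simp_all add: X_top_eq_top_of_set B_closed C_closed)
  have \<mu>: "radon_measure (top_of_set ?XC) \<mu>" using assms(2) by (simp add: topC)
  note D\<mu> = radon_measureD[OF \<mu>]
  have fin: "finite_measure \<mu>"
    using represents_finite_measure[OF assms(3) D\<mu>(1)] by (simp add: C_closed)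
  have XB: "XB_in_XC \<Omega> \<subseteq> ?XC" by (rule XB_in_XC_subset)
  have borelC: "borel_sets (top_of_set ?XC) = sets \<mu>" by (simp add: borel_sets_top_of_set D\<mu>(2))
  have comp: "{K. compactin (top_of_set ?XC) K \<and> K \<subseteq> F} = {K. compact K \<and> K \<subseteq> F}"
    if "F \<subseteq> ?XC" for F
    using that by (auto simp: compactin_subtopology)
  define repr where
    "repr \<nu> \<longleftrightarrow> radon_measure (top_of_set ?XB) \<nu> \<and> represents \<nu> (B_alg \<Omega>) L" for \<nu>
  \<comment> \<open>Any representing measure on X(B) has an image that represents L on C, so
    uniqueness on the compact space X(C) identifies the image with \<open>\<mu>\<close>.\<close>
  have push: "distr \<nu> (restrict_space borel ?XC) (res_C \<Omega>) = \<mu>" if "repr \<nu>" for \<nu>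
    using pushforward_res_C[of \<Omega> \<nu> L] that \<mu> assms(3)
    by (intro radon_measure_representing_unique[OF real_subalgebra_C_alg compact_characters_C_alg])
      (auto simp: repr_def)
  have formula: "emeasure \<nu> E = (SUP K\<in>{K. compact K \<and> K \<subseteq> res_C \<Omega> ` E}. emeasure \<mu> K)"
    if \<nu>: "repr \<nu>" and E: "E \<in> sets \<nu>" for \<nu> E
    by (subst push[OF \<nu>, symmetric], rule radon_measure_eq_SUP_distr[OF _ res_C_homeomorphism _ E])
      (use \<nu> XB in \<open>simp_all add: repr_def XB_in_XC_def\<close>)
  have sets_repr: "sets \<nu> = borel_sets (top_of_set ?XB)" if "repr \<nu>" for \<nu>
    using that radon_measureD(2)[of ?XB \<nu>] by (simp add: repr_def borel_sets_top_of_set)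
  \<comment> \<open>The right-hand side of \<open>formula\<close> involves \<open>\<mu>\<close> but
    not \<open>\<nu>\<close>.\<close>
  have unique: "\<nu> = \<nu>'" if "repr \<nu>" "repr \<nu>'" for \<nu> \<nu>'
    using that by (intro measure_eqI) (simp_all add: sets_repr formula)
  have 2: "emeasure \<mu> E = (SUP K\<in>{K. compact K \<and> K \<subseteq> XB_in_XC \<Omega> \<inter> E}. emeasure \<mu> K)"
    if \<nu>: "repr \<nu>" and E: "E \<in> sets \<mu>" for \<nu> E
  proof -
    have sp: "space \<nu> = ?XB" using \<nu> radon_measureD(1) by (auto simp: repr_def)
    have "continuous_on ?XB (res_C \<Omega>)" using res_C_homeomorphism[of \<Omega>] by (simp add: homeomorphism_def)
    then have meas: "res_C \<Omega> \<in> measurable \<nu> (restrict_space borel ?XC)"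
      using XB sets_repr[OF \<nu>]
      by (intro continuous_on_measurable_restrict) (auto simp: XB_in_XC_def borel_sets_top_of_set)
    have E': "E \<in> sets (restrict_space borel ?XC)" using E D\<mu>(2) by simp
    then have F: "res_C \<Omega> -` E \<inter> ?XB \<in> sets \<nu>" using measurable_sets[OF meas, of E] sp by simp
    \<comment> \<open>As \<open>\<mu>\<close> is the image of \<open>\<nu>\<close>, its value at E
      is that of \<open>\<nu>\<close> at the preimage, whose image under restriction is the trace of
      E on X(B); \<open>formula\<close> then supplies the compact sets.\<close>
    have "emeasure \<mu> E = emeasure \<nu> (res_C \<Omega> -` E \<inter> ?XB)"
      by (subst push[OF \<nu>, symmetric]) (simp add: emeasure_distr[OF meas E'] sp)
    moreover have "res_C \<Omega> ` (res_C \<Omega> -` E \<inter> ?XB) = XB_in_XC \<Omega> \<inter> E"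
      by (auto simp: XB_in_XC_def)
    ultimately show ?thesis using formula[OF \<nu> F] by simp
  qed
  let ?P1 = "\<exists>\<nu>. repr \<nu>"
    and ?P2 = "\<forall>E\<in>sets \<mu>. emeasure \<mu> E = (SUP K\<in>{K. compact K \<and> K \<subseteq> XB_in_XC \<Omega> \<inter> E}. emeasure \<mu> K)"
    and ?P3 = "emeasure \<mu> ?XC = (SUP K\<in>{K. compact K \<and> K \<subseteq> XB_in_XC \<Omega>}. emeasure \<mu> K)"
    and ?P4 = "\<exists>E\<in>sets \<mu>. E \<subseteq> XB_in_XC \<Omega> \<and> supported_by \<mu> E"
  have 12: "?P1 \<Longrightarrow> ?P2" using 2 by blast
  \<comment> \<open>Condition (3) is the instance of (2) at the whole space.\<close>
  have 23: ?P3 if ?P2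
    using bspec[OF that sets.top] unfolding D\<mu>(1) Int_absorb2[OF XB] .
  have 34: "?P3 \<Longrightarrow> ?P4" using support_of_SUP_compact[OF \<mu> fin XB] .
  have 41: "?P4 \<Longrightarrow> ?P1"
    using representing_measure_of_support[OF assms(1) \<mu> assms(3)] by (auto simp: repr_def)
  have S2: "(\<forall>E\<in>sets \<mu>. emeasure \<mu> E =
      (SUP K\<in>{K. compactin (top_of_set ?XC) K \<and> K \<subseteq> XB_in_XC \<Omega> \<inter> E}. emeasure \<mu> K)) \<longleftrightarrow> ?P2"
    unfolding comp[OF le_infI1[OF XB]] ..
  have S5: "emeasure \<nu> E = (SUP K\<in>{K. compactin (top_of_set ?XC) K \<and> K \<subseteq> res_C \<Omega> ` E}. emeasure \<mu> K)"
    if "repr \<nu>" "E \<in> borel_sets (top_of_set ?XB)" for \<nu> E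
  proof -
    have "E \<in> sets \<nu>" "E \<subseteq> ?XB"
      using that sets_repr[OF that(1)] by (auto simp: borel_sets_top_of_set sets_restrict_space)
    then have "res_C \<Omega> ` E \<subseteq> ?XC" using XB by (auto simp: XB_in_XC_def)
    then show ?thesis using formula[OF that(1) \<open>E \<in> sets \<nu>\<close>] by (simp add: comp)
  qed
  show ?thesis
    unfolding topB topC borelC S2 comp[OF XB] topspace_euclidean_subtopology repr_def[symmetric]
  proof (intro conjI)
    show "?P1 \<longleftrightarrow> ?P2" "?P1 \<longleftrightarrow> ?P3" "?P1 \<longleftrightarrow> ?P4" using 12 23 34 41 by argo+
    show "?P1 \<longrightarrow> (\<exists>!\<nu>. repr \<nu>)" using unique by auto
  qed (use S5 in auto)
qed

end
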